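(* Consider the linear stochastic system $x_{k+1}=Ax_k+v_k$, $k\in\mathbb{N}=\{0,1,\dots\}$, in $\mathbb{R}^n$ with $v_k$ i.i.d. $\mathcal{N}(0,V)$, where all eigenvalues of $A$ have modulus strictly less than $1$, and which is in its stationary state: $x_0\sim\mathcal{N}(0,X^V)$ is independent of $(v_k)_{k\ge 0}$. Let $Q\in\mathbb{R}^{n\times n}$ be symmetric positive definite, let $N\ge 1$, and let $$J_N(k)=\sum_{j=k-N+1}^{k}x_j^\top Q x_j ,\qquad k\ge N-1 .$$ Let $\Sigma\in\mathbb{R}^{Nn\times Nn}$ be the covariance matrix of $N$ consecutive states, assumed positive definite, let $\Omega=\operatorname{diag}(Q,\dots,Q)\in\mathbb{R}^{Nn\times Nn}$ ($N$ blocks), let $\lambda_1,\dots,\lambda_{Nn}$ be the eigenvalues of $\Omega\Sigma$ (with multiplicity) and $\lambda_{\max}$ the largest of them. For $\eta\in(0,1)$ define $$\chi(\xi)=-\frac1\xi\ln\frac{\eta}{2}-\frac{1}{2\xi}\ln\det(I-2\xi\Omega\Sigma)=-\frac1\xi\ln\frac{\eta}{2}-\frac{1}{2\xi}\sum_{j=1}^{Nn}\ln(1-2\xi\lambda_j),$$ $$\kappa^+=\inf_{\xi\in\left(0,\frac{1}{2\lambda_{\max}}\right)}\chi(\xi),\qquad \kappa^-=\sup_{\xi\in(-\infty,0)}\chi(\xi).$$ Then for every $\eta\in(0,1)$ and every time index $k\ge N-1$, $$\mathbb{P}\bigl[J_N(k)\notin(\kappa^-,\kappa^+)\bigr]\le\eta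 .$$
   Context: $X^V$ denotes the stationary state covariance, i.e. the solution of the Lyapunov equation $AX^VA^\top-X^V+V=0$, where $V$ is the symmetric positive semidefinite noise covariance. The matrix $\Sigma$ is the covariance matrix of the stacked vector $(x_{k-N+1}^\top,\dots,x_k^\top)^\top$; by stationarity it does not depend on $k$, and its $n\times n$ block in block row $a$ and block column $b$ ($0\le a,b\le N-1$) is $A^{a-b}X^V$ if $a\ge b$ and $X^V(A^{b-a})^\top$ if $a<b$. If $\kappa^-\ge\kappa^+$, the interval $(\kappa^-,\kappa^+)$ is empty. *)

theory Defs
  imports "HOL-Probability.Probability" "Jordan_Normal_Form.Char_Poly"
begin

definition centred_normal :: "real \<Rightarrow> real measure" where
  "centred_normal s =
     (if s = 0 then return borel 0 else density lborel (normal_density 0 (sqrt s)))"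

(* X ~ N(0, C), in the form that also makes sense for singular C: every linear functional u . X
   is univariate normal with variance u^T C u, the Dirac measure at 0 if that variance is 0. *)
definition centred_gaussian :: "'a measure \<Rightarrow> ('a \<Rightarrow> real^'n) \<Rightarrow> real^'n^'n \<Rightarrow> bool" where
  "centred_gaussian M X C \<longleftrightarrow> X \<in> borel_measurable M \<and>
     (\<forall>u. distr M borel (\<lambda>\<omega>. inner u (X \<omega>)) = centred_normal (inner u (C *v u)))"

(* N is a variable of the object logic, so the (N n) x (N n) matrices are 'a mat. The
   coordinates of real^'n are enumerated by the bijection from_nat_into UNIV from {..<CARD('n)}
   to 'n; position i < N * CARD('n) is coordinate i mod CARD('n) of block i div CARD('n). *)
definition to_mat :: "real^'n^'n \<Rightarrow> real mat" where
  "to_mat A = Matrix.mat CARD('n) CARD('n)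
     (\<lambda>(i, j). A $ from_nat_into UNIV i $ from_nat_into UNIV j)"

definition schur_stable :: "real^'n^'n \<Rightarrow> bool" where
  "schur_stable A \<longleftrightarrow> (\<forall>z. eigenvalue (map_mat complex_of_real (to_mat A)) z \<longrightarrow> cmod z < 1)"

definition pos_def :: "real mat \<Rightarrow> bool" where
  "pos_def B \<longleftrightarrow> square_mat B \<and> transpose_mat B = B \<and>
     (\<forall>u \<in> carrier_vec (dim_row B). u \<noteq> 0\<^sub>v (dim_row B) \<longrightarrow> scalar_prod u (B *\<^sub>v u) > 0)"

definition stacked :: "(nat \<Rightarrow> 'a \<Rightarrow> real^'n) \<Rightarrow> nat \<Rightarrow> 'a \<Rightarrow> real" where
  "stacked x i \<omega> = x (i div CARD('n)) \<omega> $ from_nat_into UNIV (i mod CARD('n))"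

definition covariance :: "'a measure \<Rightarrow> ('a \<Rightarrow> real) \<Rightarrow> ('a \<Rightarrow> real) \<Rightarrow> real" where
  "covariance M Y Z =
     (\<integral>\<omega>. (Y \<omega> - (\<integral>\<omega>. Y \<omega> \<partial>M)) * (Z \<omega> - (\<integral>\<omega>. Z \<omega> \<partial>M)) \<partial>M)"

(* Covariance of (x_0, ..., x_(N-1)); for a stationary process this is the covariance of any N
   consecutive states. *)
definition Sigma_mat :: "'a measure \<Rightarrow> nat \<Rightarrow> (nat \<Rightarrow> 'a \<Rightarrow> real^'n) \<Rightarrow> real mat" where
  "Sigma_mat M N x = Matrix.mat (N * CARD('n)) (N * CARD('n))
     (\<lambda>(i, j). covariance M (stacked x i) (stacked x j))"

definition Omega_mat :: "nat \<Rightarrow> real^'n^'n \<Rightarrow> real mat" where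
  "Omega_mat N Q = diag_block_mat (replicate N (to_mat Q))"

definition cost :: "real^'n^'n \<Rightarrow> nat \<Rightarrow> (nat \<Rightarrow> 'a \<Rightarrow> real^'n) \<Rightarrow> nat \<Rightarrow> 'a \<Rightarrow> real" where
  "cost Q N x k \<omega> = (\<Sum>j = k + 1 - N..k. inner (x j \<omega>) (Q *v x j \<omega>))"

definition eigvals_mset :: "real mat \<Rightarrow> real multiset" where
  "eigvals_mset B = proots (char_poly B)"

definition lambda_max :: "real mat \<Rightarrow> real" where
  "lambda_max B = Max (set_mset (eigvals_mset B))"

definition chi :: "real \<Rightarrow> real mat \<Rightarrow> real \<Rightarrow> real" where
  "chi \<eta> B \<xi> = - (1 / \<xi>) * ln (\<eta> / 2)
     - 1 / (2 * \<xi>) * ln (Determinant.det (1\<^sub>m (dim_row B) - (2 * \<xi>) \<cdot>\<^sub>m B))"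

definition kappa_plus :: "real \<Rightarrow> real mat \<Rightarrow> real" where
  "kappa_plus \<eta> B = (INF \<xi>\<in>{0<..<1 / (2 * lambda_max B)}. chi \<eta> B \<xi>)"

definition kappa_minus :: "real \<Rightarrow> real mat \<Rightarrow> real" where
  "kappa_minus \<eta> B = (SUP \<xi>\<in>{..<0}. chi \<eta> B \<xi>)"

lemma pos_def_product_eigenvalue:
  assumes W: "pos_def W" "W \<in> carrier_mat d d"
    and S: "pos_def S" "S \<in> carrier_mat d d"
    and ev: "eigenvalue (map_mat complex_of_real (W * S)) a"
  shows "Im a = 0" "Re a > 0"
proof -
  obtain z where z: "z \<in> carrier_vec d" "z \<noteq> 0\<^sub>v d"
    "map_mat complex_of_real (W * S) *\<^sub>v z = a \<cdot>\<^sub>v z"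
    using ev W S unfolding eigenvalue_def eigenvector_def by auto
  define p q where "p = map_vec Re z" and "q = map_vec Im z"
  have [simp]: "p \<in> carrier_vec d" "q \<in> carrier_vec d" using z by (auto simp: p_def q_def)
  have WS: "W * S \<in> carrier_mat d d" using W S by auto
  have part: "Re (complex_of_real c * w) = c * Re w" "Im (complex_of_real c * w) = c * Im w"
    for c w by auto
  have entry: "(\<Sum>j = 0..<d. complex_of_real ((W * S) $$ (i, j)) * (z $ j)) = a * (z $ i)"
    if "i < d" for i
    using arg_cong[OF z(3), of "\<lambda>y. y $ i"] that z(1) WS
    by (simp add: scalar_prod_def del: index_mult_mat)
  have p: "(W * S) *\<^sub>v p = Re a \<cdot>\<^sub>v p - Im a \<cdot>\<^sub>v q"
  proof (rule eq_vecI)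
    fix i assume "i < dim_vec (Re a \<cdot>\<^sub>v p - Im a \<cdot>\<^sub>v q)"
    then have "i < d" by (simp add: q_def carrier_vecD[OF z(1)])
    then show "((W * S) *\<^sub>v p) $ i = (Re a \<cdot>\<^sub>v p - Im a \<cdot>\<^sub>v q) $ i"
      using arg_cong[OF entry, of i Re] WS z(1)
      by (simp add: scalar_prod_def p_def q_def del: index_mult_mat)
  qed (use WS in \<open>auto simp: q_def carrier_vecD[OF z(1)]\<close>)
  have q: "(W * S) *\<^sub>v q = Re a \<cdot>\<^sub>v q + Im a \<cdot>\<^sub>v p"
  proof (rule eq_vecI)
    fix i assume "i < dim_vec (Re a \<cdot>\<^sub>v q + Im a \<cdot>\<^sub>v p)"
    then have "i < d" by (simp add: p_def carrier_vecD[OF z(1)])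
    then show "((W * S) *\<^sub>v q) $ i = (Re a \<cdot>\<^sub>v q + Im a \<cdot>\<^sub>v p) $ i"
      using arg_cong[OF entry, of i Im] WS z(1)
      by (simp add: scalar_prod_def p_def q_def del: index_mult_mat)
  qed (use WS in \<open>auto simp: p_def carrier_vecD[OF z(1)]\<close>)
  define P R where "P = S *\<^sub>v p" and "R = S *\<^sub>v q"
  have [simp]: "P \<in> carrier_vec d" "R \<in> carrier_vec d" using S by (auto simp: P_def R_def)
  have WP: "W *\<^sub>v P = Re a \<cdot>\<^sub>v p - Im a \<cdot>\<^sub>v q" and WR: "W *\<^sub>v R = Re a \<cdot>\<^sub>v q + Im a \<cdot>\<^sub>v p"
    using p q assoc_mult_mat_vec[OF W(2) S(2)] by (auto simp: P_def R_def)
  have sym: "scalar_prod u (B *\<^sub>v w) = scalar_prod w (B *\<^sub>v u)"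
    if "pos_def B" "B \<in> carrier_mat d d" "u \<in> carrier_vec d" "w \<in> carrier_vec d" for B u w
  proof -
    have "scalar_prod u (B *\<^sub>v w) = scalar_prod (transpose_mat B *\<^sub>v u) w"
      using transpose_vec_mult_scalar[of "B" d d w u] that by (auto simp: pos_def_def)
    then show ?thesis using that comm_scalar_prod[of w d "B *\<^sub>v u"] by (auto simp: pos_def_def)
  qed
  have nonneg: "scalar_prod u (B *\<^sub>v u) \<ge> 0"
    if "pos_def B" "B \<in> carrier_mat d d" "u \<in> carrier_vec d" for B u
    using that by (cases "u = 0\<^sub>v d") (auto simp: pos_def_def less_imp_le)
  have pos: "scalar_prod u (B *\<^sub>v u) > 0"
    if "pos_def B" "B \<in> carrier_mat d d" "u \<in> carrier_vec d" "u \<noteq> 0\<^sub>v d" for B u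
    using that by (auto simp: pos_def_def)
  have pq: "p \<noteq> 0\<^sub>v d \<or> q \<noteq> 0\<^sub>v d"
  proof (rule ccontr)
    assume "\<not> ?thesis"
    then have "p $ i = 0" "q $ i = 0" if "i < d" for i using that by auto
    then have "z $ i = 0" if "i < d" for i
      using that z(1) by (auto simp: p_def q_def complex_eq_iff)
    then show False using z by (auto intro!: eq_vecI)
  qed
  define s where "s = scalar_prod p P + scalar_prod q R"
  have s: "s > 0"
    using pq pos[OF S, of p] pos[OF S, of q] nonneg[OF S, of p] nonneg[OF S, of q]
    unfolding s_def P_def R_def by fastforce
  have cross: "scalar_prod q P = scalar_prod p R"
    using sym[OF S, of p q] by (simp add: P_def R_def)
  have comm: "scalar_prod u w = scalar_prod w u"
    if "u \<in> carrier_vec d" "w \<in> carrier_vec d" for u w :: "real vec"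
    using that by (rule comm_scalar_prod)
  have "scalar_prod R (W *\<^sub>v P) = Re a * scalar_prod p R - Im a * scalar_prod q R"
    unfolding WP by (subst scalar_prod_minus_distrib[of _ d]) (auto simp: comm[of R] smult_scalar_prod_distrib[of _ d])
  moreover have "scalar_prod P (W *\<^sub>v R) = Re a * scalar_prod p R + Im a * scalar_prod p P"
    unfolding WR by (subst scalar_prod_add_distrib[of _ d]) (auto simp: comm[of P] cross smult_scalar_prod_distrib[of _ d])
  ultimately have "Im a * s = 0"
    using sym[OF W, of P R] by (simp add: s_def algebra_simps)
  then show im: "Im a = 0" using s by simp
  have "scalar_prod P (W *\<^sub>v P) = Re a * scalar_prod p P"
    unfolding WP im by (subst scalar_prod_minus_distrib[of _ d]) (auto simp: comm[of P] smult_scalar_prod_distrib[of _ d])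
  moreover have "scalar_prod R (W *\<^sub>v R) = Re a * scalar_prod q R"
    unfolding WR im by (subst scalar_prod_add_distrib[of _ d]) (auto simp: comm[of R] smult_scalar_prod_distrib[of _ d])
  ultimately have "Re a * s \<ge> 0"
    using nonneg[OF W, of P] nonneg[OF W, of R] by (simp add: s_def algebra_simps)
  moreover have "Re a \<noteq> 0"
  proof
    assume 0: "Re a = 0"
    have "P = 0\<^sub>v d" using pos[OF W, of P] \<open>scalar_prod P (W *\<^sub>v P) = _\<close> 0 by auto
    moreover have "R = 0\<^sub>v d" using pos[OF W, of R] \<open>scalar_prod R (W *\<^sub>v R) = _\<close> 0 by auto
    ultimately show False using s by (simp add: s_def)
  qed
  ultimately show "Re a > 0" using s by (simp add: zero_le_mult_iff)
qed

lemma char_poly_pos_def_product: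
  assumes W: "pos_def W" "W \<in> carrier_mat d d"
    and S: "pos_def S" "S \<in> carrier_mat d d"
  obtains as where "char_poly (W * S) = (\<Prod>a\<leftarrow>as. [:- a, 1:])" "length as = d"
    "\<And>a. a \<in> set as \<Longrightarrow> a > 0"
proof -
  let ?B = "W * S"
  have B: "?B \<in> carrier_mat d d" using W S by auto
  then have cB: "map_mat complex_of_real ?B \<in> carrier_mat d d" by auto
  obtain cs where cs: "char_poly (map_mat complex_of_real ?B) = (\<Prod>a\<leftarrow>cs. [:- a, 1:])"
    "length cs = d"
    using char_poly_factorized[OF cB] by auto
  have ev: "Im a = 0" "Re a > 0" if "a \<in> set cs" for a
  proof -
    have "poly (\<Prod>a\<leftarrow>cs. [:- a, 1:]) a = 0" using that by (induction cs) auto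
    then have "eigenvalue (map_mat complex_of_real ?B) a"
      using eigenvalue_root_char_poly[OF cB] cs by simp
    then show "Im a = 0" "Re a > 0" using pos_def_product_eigenvalue[OF W S] by auto
  qed
  interpret of_real_poly: map_poly_inj_idom_hom complex_of_real ..
  have "map_poly complex_of_real (\<Prod>a\<leftarrow>map Re cs. [:- a, 1:]) = (\<Prod>a\<leftarrow>cs. [:- a, 1:])"
    using ev(1)
  proof (induction cs)
    case (Cons c cs)
    then have "complex_of_real (Re c) = c" by (simp add: complex_eq_iff)
    moreover have "map_poly complex_of_real (\<Prod>a\<leftarrow>map Re cs. [:- a, 1:]) = (\<Prod>a\<leftarrow>cs. [:- a, 1:])"
      using Cons by auto
    ultimately show ?case by (simp add: of_real_poly.hom_mult del: mult_pCons_left)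
  qed auto
  then have "map_poly complex_of_real (\<Prod>a\<leftarrow>map Re cs. [:- a, 1:])
      = map_poly complex_of_real (char_poly ?B)"
    using cs(1) of_real_hom.char_poly_hom[OF B, where 'a = complex] by simp
  then have "char_poly ?B = (\<Prod>a\<leftarrow>map Re cs. [:- a, 1:])"
    using of_real_poly.injectivity by metis
  then show thesis using that[of "map Re cs"] cs ev by auto
qed

lemma det_one_minus_smult:
  fixes B :: "real mat"
  assumes B: "B \<in> carrier_mat d d" and as: "char_poly B = (\<Prod>a\<leftarrow>as. [:- a, 1:])" "length as = d"
  shows "Determinant.det (1\<^sub>m d - c \<cdot>\<^sub>m B) = (\<Prod>a\<leftarrow>as. 1 - c * a)"
proof (cases "c = 0")
  case True
  then have "1\<^sub>m d - c \<cdot>\<^sub>m B = 1\<^sub>m d" using B by (intro eq_matI) auto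
  then show ?thesis using True by (simp add: map_replicate_const)
next
  case False
  have "1\<^sub>m d - c \<cdot>\<^sub>m B = c \<cdot>\<^sub>m (- char_matrix B (1 / c))"
    using B False by (intro eq_matI) (auto simp: char_matrix_def field_simps)
  then have "Determinant.det (1\<^sub>m d - c \<cdot>\<^sub>m B) = c ^ d * poly (char_poly B) (1 / c)"
    using char_poly_matrix[OF B, of "1 / c"] B by (simp add: char_matrix_def)
  also have "\<dots> = c ^ length as * (\<Prod>a\<leftarrow>as. 1 / c - a)"
    by (simp add: as poly_prod_list o_def)
  also have "\<dots> = (\<Prod>a\<leftarrow>as. 1 - c * a)"
    by (induction as) (use False in \<open>auto simp: field_simps\<close>)
  finally show ?thesis .
qed

(* All d eigenvalues of W * S are real and positive, counted with multiplicity, and on the ranges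
   used for kappa_plus and kappa_minus the determinant form of chi is the sum over them. *)
lemma
  assumes W: "pos_def W" "W \<in> carrier_mat d d"
    and S: "pos_def S" "S \<in> carrier_mat d d"
  shows size_eigvals: "size (eigvals_mset (W * S)) = d"
    and eigvals_pos: "\<And>a. a \<in># eigvals_mset (W * S) \<Longrightarrow> a > 0"
    and chi_eq_sum: "\<xi> < 0 \<or> 0 < \<xi> \<and> \<xi> < 1 / (2 * lambda_max (W * S)) \<Longrightarrow>
      chi \<eta> (W * S) \<xi> = - (1 / \<xi>) * ln (\<eta> / 2)
        - 1 / (2 * \<xi>) * (\<Sum>a\<in>#eigvals_mset (W * S). ln (1 - 2 * \<xi> * a))"
proof -
  have B: "W * S \<in> carrier_mat d d" using W S by auto
  obtain as where as: "char_poly (W * S) = (\<Prod>a\<leftarrow>as. [:- a, 1:])" "length as = d"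
    "\<And>a. a \<in> set as \<Longrightarrow> a > 0"
    using char_poly_pos_def_product[OF W S] by metis
  have "proots (\<Prod>a\<leftarrow>as. [:- a, 1:]) = mset as"
  proof (induction as)
    case (Cons a as)
    have "(\<Prod>a\<leftarrow>as. [:- a, 1:]) \<noteq> 0" by (auto simp: prod_list_zero_iff)
    then have "proots ([:- a, 1:] * (\<Prod>a\<leftarrow>as. [:- a, 1:])) = {#a#} + mset as"
      using Cons by (subst proots_mult) (auto simp del: mult_pCons_left)
    then show ?case by simp
  qed auto
  then have ms: "eigvals_mset (W * S) = mset as" by (simp add: eigvals_mset_def as)
  show "size (eigvals_mset (W * S)) = d" by (simp add: ms as)
  show "\<And>a. a \<in># eigvals_mset (W * S) \<Longrightarrow> a > 0" using as by (simp add: ms)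
  assume xi: "\<xi> < 0 \<or> 0 < \<xi> \<and> \<xi> < 1 / (2 * lambda_max (W * S))"
  have pos: "1 - 2 * \<xi> * a > 0" if "a \<in> set as" for a
  proof (cases "\<xi> < 0")
    case True
    then show ?thesis using as(3)[OF that] mult_neg_pos[of \<xi> a] by simp
  next
    case False
    have "a \<le> lambda_max (W * S)" using that by (simp add: lambda_max_def ms)
    then have "2 * \<xi> * a \<le> 2 * \<xi> * lambda_max (W * S)" using False by (intro mult_left_mono) auto
    also have "\<dots> < 1" using False xi as(3)[OF that] \<open>a \<le> _\<close> by (simp add: field_simps)
    finally show ?thesis by simp
  qed
  have "ln (\<Prod>a\<leftarrow>as. 1 - 2 * \<xi> * a) = (\<Sum>a\<leftarrow>as. ln (1 - 2 * \<xi> * a)) \<and> (\<Prod>a\<leftarrow>as. 1 - 2 * \<xi> * a) > 0"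
    using pos
  proof (induction as)
    case (Cons a as)
    have "1 - 2 * \<xi> * a > 0" by (rule Cons.prems) simp
    moreover have IH: "ln (\<Prod>a\<leftarrow>as. 1 - 2 * \<xi> * a) = (\<Sum>a\<leftarrow>as. ln (1 - 2 * \<xi> * a))"
      "(\<Prod>a\<leftarrow>as. 1 - 2 * \<xi> * a) > 0" using Cons by auto
    ultimately show ?case
      using ln_mult_pos[of "1 - 2 * \<xi> * a" "\<Prod>a\<leftarrow>as. 1 - 2 * \<xi> * a"]
        mult_pos_pos[of "1 - 2 * \<xi> * a" "\<Prod>a\<leftarrow>as. 1 - 2 * \<xi> * a"]
      by (simp only: list.map prod_list.Cons sum_list.Cons)
  qed auto
  then show "chi \<eta> (W * S) \<xi> = - (1 / \<xi>) * ln (\<eta> / 2)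
        - 1 / (2 * \<xi>) * (\<Sum>a\<in>#eigvals_mset (W * S). ln (1 - 2 * \<xi> * a))"
    using det_one_minus_smult[OF B as(1,2), of "2 * \<xi>"] W
    by (simp add: chi_def ms sum_mset_sum_list[symmetric] flip: mset_map)
qed

end

(*
The quadratic form J = sum_j a_j z_j^2 of the stacked vector is diagonalised simultaneously with
its covariance: there is P with P^T Sigma P = 1 and Omega = P diag(a) P^T, where the a_j are the
eigenvalues of Omega Sigma (triangularise Omega Sigma by Schur, orthonormalise the flag with respect
to Sigma by Gram-Schmidt, and note that a symmetric triangular matrix is diagonal). The coordinates
z = P^T x have the property that every linear combination sum_j t_j z_j is N(0, sum_j t_j^2), at
every time, because the Lyapunov equation makes the variance of a functional of the window
time-independent. Linearising the squares by an auxiliary Gaussian vector then gives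
E exp(xi J) = prod_j (1 - 2 xi a_j)^(-1/2), i.e. (eta / 2) exp(xi chi(xi)), and Chernoff's bound yields
P(J >= kappa_plus) <= eta / 2 and P(J <= kappa_minus) <= eta / 2. Neither extremum needs to be
attained: an approximating sequence of xi suffices if it is bounded, which for kappa_minus holds
because chi tends to 0 at -infinity but is positive somewhere.
*)
theory Submission
  imports Defs
    "HOL-Real_Asymp.Real_Asymp"
    "Jordan_Normal_Form.Schur_Decomposition"
    "Jordan_Normal_Form.Spectral_Radius"
begin

text \<open>Only laws of one-dimensional linear functionals are compared; no joint density of the
  window is formed, so a singular \<open>V\<close> needs no separate treatment. The sign of xi
  decides the analysis. For xi > 0 the auxiliary Gaussian enters with real exponents; the integrands
  are positive but unbounded, and Tonelli's theorem for nonnegative integrals applies. For xi < 0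
  the real coefficient would be the square root of a negative number; imaginary exponents replace
  it, and the bounded complex integrands permit Fubini's theorem for Bochner integrals. A further
  obstacle is that \<open>INF\<close> and \<open>SUP\<close> of reals carry information only under
  the matching bound: chi is nonnegative on the positive range and at most the trace of Omega Sigma
  for xi < 0.\<close>

no_notation Matrix.vec_index (infixl "$" 100)

section \<open>Centred normal laws\<close>

text \<open>Scaling a standard normal variable covers the Dirac case and the density case at once,
  so that later computations need no case distinction.\<close>

lemma centred_normal_eq_distr_std_normal:
  assumes "s \<ge> 0"
  shows "centred_normal s = distr std_normal_distribution borel (\<lambda>g. sqrt s * g)"
proof (cases "s = 0")
  case True
  interpret prob_space std_normal_distribution by (rule prob_space_normal_density) simp
  show ?thesis
    using True distr_const[of 0 borel] by (simp add: centred_normal_def)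
next
  case False
  interpret prob_space std_normal_distribution by (rule prob_space_normal_density) simp
  have "distributed std_normal_distribution lborel (\<lambda>x. x) std_normal_density"
    by (auto simp: distributed_def distr_id2)
  from normal_density_affine[OF this, of "sqrt s" 0] False assms
  have "distributed std_normal_distribution lborel (\<lambda>x. sqrt s * x) (normal_density 0 (sqrt s))"
    by simp
  then have "distr std_normal_distribution lborel (\<lambda>x. sqrt s * x) = density lborel (normal_density 0 (sqrt s))"
    by (simp add: distributed_def)
  moreover have "distr std_normal_distribution borel (\<lambda>x. sqrt s * x) = distr std_normal_distribution lborel (\<lambda>x. sqrt s * x)"
    by (rule distr_cong) auto
  ultimately show ?thesis using False by (simp add: centred_normal_def)
qed

lemma real_distribution_centred_normal:
  assumes "s \<ge> 0"
  shows "real_distribution (centred_normal s)"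
proof -
  interpret prob_space std_normal_distribution by (rule prob_space_normal_density) simp
  show ?thesis
    unfolding centred_normal_eq_distr_std_normal[OF assms] by (rule real_distribution_distr) simp
qed

lemma char_centred_normal:
  assumes "s \<ge> 0"
  shows "char (centred_normal s) t = complex_of_real (exp (- (s * t\<^sup>2) / 2))"
proof -
  have "char (centred_normal s) t = (\<integral>x. iexp (t * (sqrt s * x)) \<partial>std_normal_distribution)"
    unfolding char_def centred_normal_eq_distr_std_normal[OF assms] by (subst integral_distr) auto
  also have "\<dots> = char std_normal_distribution (sqrt s * t)"
    unfolding char_def by (intro Bochner_Integration.integral_cong) (auto simp: mult_ac)
  also have "\<dots> = complex_of_real (exp (- (s * t\<^sup>2) / 2))"
    using assms by (simp add: char_std_normal_distribution power_mult_distrib)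
  finally show ?thesis .
qed

lemma centred_normal_moments:
  assumes "s \<ge> 0"
  shows "integrable (centred_normal s) (\<lambda>x. x)" "integral\<^sup>L (centred_normal s) (\<lambda>x. x) = 0"
    "integrable (centred_normal s) (\<lambda>x. x\<^sup>2)" "integral\<^sup>L (centred_normal s) (\<lambda>x. x\<^sup>2) = s"
proof -
  have 1: "integrable std_normal_distribution (\<lambda>x. x)" "(\<integral>x. x \<partial>std_normal_distribution) = 0"
    using integrable_std_normal_distribution_moment[of 1] integral_std_normal_distribution_moment_odd[of 1]
    by simp_all
  have 2: "integrable std_normal_distribution (\<lambda>x. x\<^sup>2)" "(\<integral>x. x\<^sup>2 \<partial>std_normal_distribution) = 1"
    using integrable_std_normal_distribution_moment[of 2]
      std_normal_distribution_even_moments(1)[of 1, unfolded mult_1_right power_one_right fact_1 fact_2]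
    by (simp_all only: mult_1_right divide_self[OF zero_neq_numeral[symmetric]])
  note eq = centred_normal_eq_distr_std_normal[OF assms]
  have mult: "(\<lambda>x. sqrt s * x) \<in> std_normal_distribution \<rightarrow>\<^sub>M borel" by simp
  have meas1: "(\<lambda>x. x) \<in> borel_measurable (borel :: real measure)" by simp
  have meas2: "(\<lambda>x. x\<^sup>2) \<in> borel_measurable (borel :: real measure)" by simp
  show "integrable (centred_normal s) (\<lambda>x. x)"
    unfolding eq integrable_distr_eq[OF mult meas1] using 1(1) by (rule integrable_mult_right)
  have "integral\<^sup>L (centred_normal s) (\<lambda>x. x) = (\<integral>x. sqrt s * x \<partial>std_normal_distribution)"
    unfolding eq by (rule integral_distr[OF mult meas1])
  also have "\<dots> = sqrt s * (\<integral>x. x \<partial>std_normal_distribution)" by (rule integral_mult_right_zero)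
  finally show "integral\<^sup>L (centred_normal s) (\<lambda>x. x) = 0" using 1 by simp
  have sq: "(sqrt s * x)\<^sup>2 = s * x\<^sup>2" for x using assms by (simp add: power_mult_distrib)
  show "integrable (centred_normal s) (\<lambda>x. x\<^sup>2)"
    unfolding eq integrable_distr_eq[OF mult meas2] sq using 2(1) by (rule integrable_mult_right)
  have "integral\<^sup>L (centred_normal s) (\<lambda>x. x\<^sup>2) = (\<integral>x. (sqrt s * x)\<^sup>2 \<partial>std_normal_distribution)"
    unfolding eq by (rule integral_distr[OF mult meas2])
  also have "\<dots> = s * (\<integral>x. x\<^sup>2 \<partial>std_normal_distribution)" unfolding sq by (rule integral_mult_right_zero)
  finally show "integral\<^sup>L (centred_normal s) (\<lambda>x. x\<^sup>2) = s" using 2 by simp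
qed

section \<open>Exponential moments of normal variables and of sums of their squares\<close>

lemma nn_integral_exp_std_normal:
  "(\<integral>\<^sup>+g. ennreal (exp (s * g)) \<partial>std_normal_distribution) = ennreal (exp (s\<^sup>2 / 2))"
proof -
  \<comment> \<open>Completing the square: the tilted density is a constant times the normal density
    with mean \<open>s\<close>.\<close>
  have "(\<integral>\<^sup>+g. ennreal (exp (s * g)) \<partial>std_normal_distribution)
      = (\<integral>\<^sup>+g. ennreal (exp (s\<^sup>2 / 2)) * ennreal (normal_density s 1 g) \<partial>lborel)"
    by (subst nn_integral_density)
      (auto intro!: nn_integral_cong
        simp: ennreal_mult' [symmetric] normal_density_def exp_add[symmetric] power2_eq_square field_simps)
  also have "\<dots> = ennreal (exp (s\<^sup>2 / 2)) * (\<integral>\<^sup>+g. ennreal (normal_density s 1 g) \<partial>lborel)"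
    by (rule nn_integral_cmult) auto
  also have "(\<integral>\<^sup>+g. ennreal (normal_density s 1 g) \<partial>lborel) = 1"
    by (subst nn_integral_eq_integral) auto
  finally show ?thesis by simp
qed

text \<open>The weight turns the standard normal density into \<open>\<sigma>\<close> times a
  centred normal density with variance 1 / (1 - 2a). Negative \<open>a\<close> is included and is
  used later.\<close>

lemma nn_integral_exp_square_std_normal:
  assumes "2 * a < 1"
  shows "(\<integral>\<^sup>+g. ennreal (exp (a * g\<^sup>2)) \<partial>std_normal_distribution) = ennreal (1 / sqrt (1 - 2 * a))"
proof -
  define \<sigma> where "\<sigma> = 1 / sqrt (1 - 2 * a)"
  have \<sigma>: "\<sigma> > 0" "\<sigma>\<^sup>2 = 1 / (1 - 2 * a)" using assms by (auto simp: \<sigma>_def power_divide)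
  have *: "std_normal_density g * exp (a * g\<^sup>2) = \<sigma> * normal_density 0 \<sigma> g" for g
  proof -
    have "sqrt (2 * pi * \<sigma>\<^sup>2) = sqrt (2 * pi) * \<sigma>" using \<sigma>(1) by (simp add: real_sqrt_mult)
    moreover have "- g\<^sup>2 / 2 + a * g\<^sup>2 = - g\<^sup>2 / (2 * \<sigma>\<^sup>2)"
      using assms unfolding \<sigma>(2) by (simp add: field_simps)
    ultimately show ?thesis
      using \<sigma>(1) by (simp add: normal_density_def exp_add[symmetric])
  qed
  have "(\<integral>\<^sup>+g. ennreal (exp (a * g\<^sup>2)) \<partial>std_normal_distribution)
      = (\<integral>\<^sup>+g. ennreal \<sigma> * ennreal (normal_density 0 \<sigma> g) \<partial>lborel)"
    using \<sigma>(1) by (subst nn_integral_density)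
      (auto intro!: nn_integral_cong simp: ennreal_mult' [symmetric] *)
  also have "\<dots> = ennreal \<sigma> * (\<integral>\<^sup>+g. ennreal (normal_density 0 \<sigma> g) \<partial>lborel)"
    by (rule nn_integral_cmult) auto
  also have "(\<integral>\<^sup>+g. ennreal (normal_density 0 \<sigma> g) \<partial>lborel) = 1"
    using \<sigma>(1) by (subst nn_integral_eq_integral) auto
  finally show ?thesis by (simp add: \<sigma>_def)
qed

lemma (in prob_space)
  assumes X: "X \<in> borel_measurable M" and "distr M borel X = centred_normal s" "s \<ge> 0"
  shows nn_integral_exp_centred_normal: "(\<integral>\<^sup>+\<omega>. ennreal (exp (X \<omega>)) \<partial>M) = ennreal (exp (s / 2))"
    and integral_iexp_centred_normal: "(\<integral>\<omega>. iexp (X \<omega>) \<partial>M) = complex_of_real (exp (- s / 2))"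
proof -
  have "(\<integral>\<^sup>+\<omega>. ennreal (exp (X \<omega>)) \<partial>M) = (\<integral>\<^sup>+y. ennreal (exp y) \<partial>distr M borel X)"
    using X by (subst nn_integral_distr) auto
  also have "\<dots> = (\<integral>\<^sup>+g. ennreal (exp (sqrt s * g)) \<partial>std_normal_distribution)"
    unfolding assms(2) centred_normal_eq_distr_std_normal[OF assms(3)] by (subst nn_integral_distr) auto
  finally show "(\<integral>\<^sup>+\<omega>. ennreal (exp (X \<omega>)) \<partial>M) = ennreal (exp (s / 2))"
    using assms(3) by (simp add: nn_integral_exp_std_normal)
  have "(\<integral>\<omega>. iexp (X \<omega>) \<partial>M) = char (distr M borel X) 1"
    using X unfolding char_def by (subst integral_distr) auto
  then show "(\<integral>\<omega>. iexp (X \<omega>) \<partial>M) = complex_of_real (exp (- s / 2))"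
    using assms by (simp add: char_centred_normal)
qed

text \<open>Characteristic functions are used instead of convolution of densities because a
  degenerate summand has no density.\<close>

lemma (in prob_space) centred_normal_add:
  assumes "indep_var borel X borel Y"
    and "distr M borel X = centred_normal s" "s \<ge> 0" "distr M borel Y = centred_normal t" "t \<ge> 0"
  shows "distr M borel (\<lambda>\<omega>. X \<omega> + Y \<omega>) = centred_normal (s + t)"
proof (rule Levy_uniqueness)
  have [measurable]: "X \<in> borel_measurable M" "Y \<in> borel_measurable M"
    using assms(1) by (auto dest: indep_var_rv1 indep_var_rv2)
  show "real_distribution (distr M borel (\<lambda>\<omega>. X \<omega> + Y \<omega>))" by (rule real_distribution_distr) simp
  show "real_distribution (centred_normal (s + t))"
    using assms by (intro real_distribution_centred_normal) simp
  show "char (distr M borel (\<lambda>\<omega>. X \<omega> + Y \<omega>)) = char (centred_normal (s + t))"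
    using assms by (auto simp: char_distr_add char_centred_normal distrib_right add_divide_distrib
        exp_add[symmetric] simp flip: of_real_mult)
qed

lemma (in prob_space) centred_normal_sum:
  assumes "indep_vars (\<lambda>_. borel) Y I" "finite I"
    and "\<And>i. i \<in> I \<Longrightarrow> distr M borel (Y i) = centred_normal (s i)" "\<And>i. i \<in> I \<Longrightarrow> s i \<ge> 0"
  shows "distr M borel (\<lambda>\<omega>. \<Sum>i\<in>I. Y i \<omega>) = centred_normal (\<Sum>i\<in>I. s i)"
proof (rule Levy_uniqueness)
  have [measurable]: "Y i \<in> borel_measurable M" if "i \<in> I" for i
    using assms(1) that by (auto simp: indep_vars_def)
  show "real_distribution (distr M borel (\<lambda>\<omega>. \<Sum>i\<in>I. Y i \<omega>))" by (rule real_distribution_distr) simp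
  show "real_distribution (centred_normal (sum s I))"
    using assms by (intro real_distribution_centred_normal sum_nonneg) simp
  show "char (distr M borel (\<lambda>\<omega>. \<Sum>i\<in>I. Y i \<omega>)) = char (centred_normal (\<Sum>i\<in>I. s i))"
  proof
    fix t
    have "char (distr M borel (\<lambda>\<omega>. \<Sum>i\<in>I. Y i \<omega>)) t = (\<Prod>i\<in>I. complex_of_real (exp (- (s i * t\<^sup>2) / 2)))"
      using assms by (simp add: char_distr_sum char_centred_normal)
    also have "\<dots> = complex_of_real (exp (- ((\<Sum>i\<in>I. s i) * t\<^sup>2) / 2))"
      using assms(2) by (simp add: exp_sum[symmetric] sum_distrib_right sum_divide_distrib
          sum_negf[symmetric] flip: of_real_prod)
    finally show "char (distr M borel (\<lambda>\<omega>. \<Sum>i\<in>I. Y i \<omega>)) t = char (centred_normal (\<Sum>i\<in>I. s i)) t"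
      using assms by (simp add: char_centred_normal sum_nonneg)
  qed
qed

text \<open>Linearisation of the square (Hubbard and Stratonovich): averaging over an auxiliary
  independent standard normal vector \<open>g\<close> turns \<open>exp (a * z\<^sup>2)\<close> into the exponential of a
  functional linear in \<open>z\<close>, so that only the one-dimensional laws of linear combinations are
  needed and not the joint law of the \<open>z i\<close>.\<close>

lemma (in prob_space) nn_integral_exp_sum_squares:
  fixes z :: "'i \<Rightarrow> 'a \<Rightarrow> real"
  assumes I: "finite I" and z[measurable]: "\<And>i. i \<in> I \<Longrightarrow> z i \<in> borel_measurable M"
    and law: "\<And>t. distr M borel (\<lambda>\<omega>. \<Sum>i\<in>I. t i * z i \<omega>) = centred_normal (\<Sum>i\<in>I. (t i)\<^sup>2)"
    and a: "\<And>i. i \<in> I \<Longrightarrow> 0 \<le> a i" "\<And>i. i \<in> I \<Longrightarrow> 2 * a i < 1"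
  shows "(\<integral>\<^sup>+\<omega>. ennreal (exp (\<Sum>i\<in>I. a i * (z i \<omega>)\<^sup>2)) \<partial>M) = ennreal (\<Prod>i\<in>I. 1 / sqrt (1 - 2 * a i))"
proof -
  interpret G: prob_space std_normal_distribution by (rule prob_space_normal_density) simp
  interpret P: product_prob_space "\<lambda>_. std_normal_distribution" I ..
  interpret Q: pair_sigma_finite "Pi\<^sub>M I (\<lambda>_. std_normal_distribution)" M ..
  let ?P = "Pi\<^sub>M I (\<lambda>_. std_normal_distribution)"
  \<comment> \<open>Chosen so that averaging exp (c z g) over a standard normal g, which gives exp
    (c^2 z^2 / 2), returns exp (a z^2).\<close>
  define c where "c i = sqrt (2 * a i)" for i
  have c: "(c i)\<^sup>2 = 2 * a i" if "i \<in> I" for i using a(1)[OF that] by (simp add: c_def)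
  have "(\<integral>\<^sup>+\<omega>. ennreal (exp (\<Sum>i\<in>I. a i * (z i \<omega>)\<^sup>2)) \<partial>M)
      = (\<integral>\<^sup>+\<omega>. (\<Prod>i\<in>I. \<integral>\<^sup>+g. ennreal (exp (c i * z i \<omega> * g)) \<partial>std_normal_distribution) \<partial>M)"
    using I by (intro nn_integral_cong)
      (auto simp: nn_integral_exp_std_normal prod_ennreal exp_sum power_mult_distrib c intro!: prod.cong)
  also have "\<dots> = (\<integral>\<^sup>+\<omega>. (\<integral>\<^sup>+g. (\<Prod>i\<in>I. ennreal (exp (c i * z i \<omega> * g i))) \<partial>?P) \<partial>M)"
    by (intro nn_integral_cong P.product_nn_integral_prod[symmetric]) (auto simp: I)
  \<comment> \<open>After the exchange \<open>g\<close> is a constant in the inner integral, and the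
    exponent is a linear combination of the \<open>z i\<close>, whose law is known.\<close>
  also have "\<dots> = (\<integral>\<^sup>+g. (\<integral>\<^sup>+\<omega>. (\<Prod>i\<in>I. ennreal (exp (c i * z i \<omega> * g i))) \<partial>M) \<partial>?P)"
    by (rule Q.Fubini') measurable
  also have "\<dots> = (\<integral>\<^sup>+g. (\<Prod>i\<in>I. ennreal (exp (a i * (g i)\<^sup>2))) \<partial>?P)"
  proof (intro nn_integral_cong)
    fix g :: "'i \<Rightarrow> real"
    have "(\<integral>\<^sup>+\<omega>. (\<Prod>i\<in>I. ennreal (exp (c i * z i \<omega> * g i))) \<partial>M)
        = (\<integral>\<^sup>+\<omega>. ennreal (exp (\<Sum>i\<in>I. (c i * g i) * z i \<omega>)) \<partial>M)"
      using I by (intro nn_integral_cong) (simp add: prod_ennreal exp_sum mult_ac)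
    also have "\<dots> = ennreal (exp ((\<Sum>i\<in>I. (c i * g i)\<^sup>2) / 2))"
      by (rule nn_integral_exp_centred_normal[OF _ law]) (auto intro: sum_nonneg)
    also have "(\<Sum>i\<in>I. (c i * g i)\<^sup>2) / 2 = (\<Sum>i\<in>I. a i * (g i)\<^sup>2)"
      by (simp add: sum_divide_distrib power_mult_distrib c)
    also have "ennreal (exp \<dots>) = (\<Prod>i\<in>I. ennreal (exp (a i * (g i)\<^sup>2)))"
      using I by (simp add: prod_ennreal exp_sum)
    finally show "(\<integral>\<^sup>+\<omega>. (\<Prod>i\<in>I. ennreal (exp (c i * z i \<omega> * g i))) \<partial>M) = \<dots>" .
  qed
  also have "\<dots> = (\<Prod>i\<in>I. \<integral>\<^sup>+g. ennreal (exp (a i * g\<^sup>2)) \<partial>std_normal_distribution)"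
    by (intro P.product_nn_integral_prod) (auto simp: I)
  also have "\<dots> = ennreal (\<Prod>i\<in>I. 1 / sqrt (1 - 2 * a i))"
    using a by (subst prod_ennreal[symmetric])
      (auto simp: nn_integral_exp_square_std_normal less_imp_le intro!: prod.cong)
  finally show ?thesis .
qed

lemma integral_exp_neg_square_std_normal:
  assumes "b \<ge> 0"
  shows "(\<integral>g. exp (- (b * g\<^sup>2)) \<partial>std_normal_distribution) = 1 / sqrt (1 + 2 * b)"
proof -
  have "(\<integral>g. exp (- (b * g\<^sup>2)) \<partial>std_normal_distribution) = enn2real (\<integral>\<^sup>+g. ennreal (exp (- b * g\<^sup>2)) \<partial>std_normal_distribution)"
    by (subst integral_eq_nn_integral) auto
  also have "\<dots> = 1 / sqrt (1 + 2 * b)"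
    using nn_integral_exp_square_std_normal[of "- b"] assms by simp
  finally show ?thesis .
qed

text \<open>Counterpart with imaginary linearisation: exp (- b z^2) is the characteristic function
  of a standard normal variable at sqrt (2b) z. All factors have modulus one, which gives
  integrability on the product space.\<close>

lemma (in prob_space) integral_exp_neg_sum_squares:
  fixes z :: "'i \<Rightarrow> 'a \<Rightarrow> real"
  assumes I: "finite I" and z[measurable]: "\<And>i. i \<in> I \<Longrightarrow> z i \<in> borel_measurable M"
    and law: "\<And>t. distr M borel (\<lambda>\<omega>. \<Sum>i\<in>I. t i * z i \<omega>) = centred_normal (\<Sum>i\<in>I. (t i)\<^sup>2)"
    and b: "\<And>i. i \<in> I \<Longrightarrow> 0 \<le> b i"
  shows "(\<integral>\<omega>. exp (- (\<Sum>i\<in>I. b i * (z i \<omega>)\<^sup>2)) \<partial>M) = (\<Prod>i\<in>I. 1 / sqrt (1 + 2 * b i))"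
proof -
  interpret G: prob_space std_normal_distribution by (rule prob_space_normal_density) simp
  interpret P: product_prob_space "\<lambda>_. std_normal_distribution" I ..
  let ?P = "Pi\<^sub>M I (\<lambda>_. std_normal_distribution)"
  interpret Q: pair_prob_space "?P" M ..
  define c where "c i = sqrt (2 * b i)" for i
  have c: "(c i)\<^sup>2 = 2 * b i" if "i \<in> I" for i using b[OF that] by (simp add: c_def)
  have "complex_of_real (\<integral>\<omega>. exp (- (\<Sum>i\<in>I. b i * (z i \<omega>)\<^sup>2)) \<partial>M)
      = (\<integral>\<omega>. complex_of_real (exp (- (\<Sum>i\<in>I. b i * (z i \<omega>)\<^sup>2))) \<partial>M)"
    by simp
  also have "\<dots> = (\<integral>\<omega>. (\<Prod>i\<in>I. \<integral>g. iexp (c i * z i \<omega> * g) \<partial>std_normal_distribution) \<partial>M)"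
  proof (intro Bochner_Integration.integral_cong refl)
    fix \<omega>
    have "(\<integral>g. iexp (c i * z i \<omega> * g) \<partial>std_normal_distribution) = complex_of_real (exp (- (b i * (z i \<omega>)\<^sup>2)))"
      if "i \<in> I" for i
      using fun_cong[OF char_std_normal_distribution, of "c i * z i \<omega>"]
      by (simp add: char_def power_mult_distrib c[OF that])
    then show "complex_of_real (exp (- (\<Sum>i\<in>I. b i * (z i \<omega>)\<^sup>2)))
        = (\<Prod>i\<in>I. \<integral>g. iexp (c i * z i \<omega> * g) \<partial>std_normal_distribution)"
      using I by (simp add: sum_negf[symmetric] exp_sum)
  qed
  also have "\<dots> = (\<integral>\<omega>. (\<integral>g. (\<Prod>i\<in>I. iexp (c i * z i \<omega> * g i)) \<partial>?P) \<partial>M)"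
    by (intro Bochner_Integration.integral_cong refl P.product_integral_prod[symmetric] I
        G.integrable_const_bound[where B = 1]) auto
  also have "\<dots> = (\<integral>g. (\<integral>\<omega>. (\<Prod>i\<in>I. iexp (c i * z i \<omega> * g i)) \<partial>M) \<partial>?P)"
  proof (rule Q.Fubini_integral)
    have "norm (\<Prod>i\<in>I. iexp (c i * z i \<omega> * g i)) \<le> 1" for g :: "'i \<Rightarrow> real" and \<omega>
      by (auto simp: prod_norm[symmetric] norm_exp_i_times simp del: of_real_mult intro!: prod_le_1)
    then show "integrable (?P \<Otimes>\<^sub>M M) (\<lambda>(g, \<omega>). \<Prod>i\<in>I. iexp (c i * z i \<omega> * g i))"
      by (intro Q.P.integrable_const_bound[where B = 1]) auto
  qed
  also have "\<dots> = (\<integral>g. (\<Prod>i\<in>I. complex_of_real (exp (- (b i * (g i)\<^sup>2)))) \<partial>?P)"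
  proof (intro Bochner_Integration.integral_cong refl)
    fix g :: "'i \<Rightarrow> real"
    have "(\<integral>\<omega>. (\<Prod>i\<in>I. iexp (c i * z i \<omega> * g i)) \<partial>M)
        = (\<integral>\<omega>. iexp (\<Sum>i\<in>I. (c i * g i) * z i \<omega>) \<partial>M)"
      using I by (intro Bochner_Integration.integral_cong refl)
        (simp add: exp_sum[symmetric] sum_distrib_left mult_ac)
    also have "\<dots> = complex_of_real (exp (- (\<Sum>i\<in>I. (c i * g i)\<^sup>2) / 2))"
      by (rule integral_iexp_centred_normal[OF _ law]) (auto intro: sum_nonneg)
    also have "- (\<Sum>i\<in>I. (c i * g i)\<^sup>2) / 2 = (\<Sum>i\<in>I. - (b i * (g i)\<^sup>2))"
      by (simp add: sum_divide_distrib power_mult_distrib c sum_negf[symmetric])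
    also have "complex_of_real (exp \<dots>) = (\<Prod>i\<in>I. complex_of_real (exp (- (b i * (g i)\<^sup>2))))"
      using I by (simp only: exp_sum of_real_prod)
    finally show "(\<integral>\<omega>. (\<Prod>i\<in>I. iexp (c i * z i \<omega> * g i)) \<partial>M) = \<dots>" .
  qed
  also have "\<dots> = (\<Prod>i\<in>I. \<integral>g. complex_of_real (exp (- (b i * g\<^sup>2))) \<partial>std_normal_distribution)"
    by (intro P.product_integral_prod I G.integrable_const_bound[where B = 1])
      (use b in \<open>auto simp: norm_mult\<close>)
  also have "\<dots> = complex_of_real (\<Prod>i\<in>I. 1 / sqrt (1 + 2 * b i))"
    using b by (simp add: integral_exp_neg_square_std_normal)
  finally show ?thesis by (simp only: of_real_eq_iff)
qed

section \<open>Chernoff bounds\<close>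

text \<open>Chernoff's bound at \<open>\<xi>\<close> is \<open>\<delta>\<close> times exp (xi (f xi
  - kappa)). If f xi is within e of the infimum, the excess factor is at most exp (R e) because xi <
  R, and it disappears as e tends to 0.\<close>

lemma (in prob_space) prob_ge_INF_le:
  fixes J :: "'a \<Rightarrow> real"
  assumes J[measurable]: "J \<in> borel_measurable M" and "0 < R" "0 \<le> \<delta>"
    and bdd: "bdd_below (f ` {0<..<R})"
    and mgf: "\<And>\<xi>. 0 < \<xi> \<Longrightarrow> \<xi> < R \<Longrightarrow> (\<integral>\<^sup>+\<omega>. ennreal (exp (\<xi> * J \<omega>)) \<partial>M) \<le> ennreal (\<delta> * exp (\<xi> * f \<xi>))"
  shows "\<P>(\<omega> in M. J \<omega> \<ge> (INF \<xi>\<in>{0<..<R}. f \<xi>)) \<le> \<delta>"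
proof -
  define \<kappa> where "\<kappa> = (INF \<xi>\<in>{0<..<R}. f \<xi>)"
  have *: "\<P>(\<omega> in M. J \<omega> \<ge> \<kappa>) \<le> \<delta> * exp (R * e)" if "e > 0" for e
  proof -
    have "{0<..<R} \<noteq> {}" using assms by auto
    with bdd that obtain \<xi> where \<xi>: "0 < \<xi>" "\<xi> < R" "f \<xi> < \<kappa> + e"
      using cINF_less_iff[of "{0<..<R}" f "\<kappa> + e"] unfolding \<kappa>_def by auto
    have "emeasure M {\<omega>\<in>space M. J \<omega> \<ge> \<kappa>}
        \<le> ennreal (exp (- \<xi> * \<kappa>)) * (\<integral>\<^sup>+\<omega>. ennreal (exp (\<xi> * J \<omega>)) * indicator (space M) \<omega> \<partial>M)"
      by (rule Chernoff_ineq_nn_integral_ge) (use \<xi> in auto)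
    also have "(\<integral>\<^sup>+\<omega>. ennreal (exp (\<xi> * J \<omega>)) * indicator (space M) \<omega> \<partial>M)
        = (\<integral>\<^sup>+\<omega>. ennreal (exp (\<xi> * J \<omega>)) \<partial>M)"
      by (rule nn_integral_cong) auto
    also have "ennreal (exp (- \<xi> * \<kappa>)) * \<dots> \<le> ennreal (exp (- \<xi> * \<kappa>)) * ennreal (\<delta> * exp (\<xi> * f \<xi>))"
      by (intro mult_left_mono mgf \<xi>) auto
    also have "\<dots> = ennreal (\<delta> * exp (\<xi> * (f \<xi> - \<kappa>)))"
      using \<open>0 \<le> \<delta>\<close> by (simp add: ennreal_mult'[symmetric] exp_diff exp_minus algebra_simps divide_inverse)
    also have "\<dots> \<le> ennreal (\<delta> * exp (R * e))"
    proof -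
      have "\<xi> * (f \<xi> - \<kappa>) \<le> \<xi> * e" using \<xi> by (intro mult_left_mono) auto
      also have "\<dots> \<le> R * e" using \<xi> that by (intro mult_right_mono) auto
      finally show ?thesis using \<open>0 \<le> \<delta>\<close> by (intro ennreal_leI mult_left_mono) auto
    qed
    finally show ?thesis using \<open>0 \<le> \<delta>\<close> by (simp add: emeasure_eq_measure)
  qed
  have "((\<lambda>e. \<delta> * exp (R * e)) \<longlongrightarrow> \<delta> * exp (R * 0)) (at_right 0)"
    by (intro tendsto_intros)
  then have "\<P>(\<omega> in M. J \<omega> \<ge> \<kappa>) \<le> \<delta> * exp (R * 0)"
    by (rule tendsto_lowerbound) (auto simp: eventually_at_right_less * intro: eventually_at_rightI[of 0 1])
  then show ?thesis by (simp add: \<kappa>_def)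
qed

lemma (in prob_space) prob_le_SUP_le:
  fixes J :: "'a \<Rightarrow> real"
  assumes J[measurable]: "J \<in> borel_measurable M" and "0 \<le> \<delta>"
    and bdd: "bdd_above (f ` {..<0})"
    and tail: "\<xi>\<^sub>0 < 0" "\<And>\<xi>. \<xi> < - R \<Longrightarrow> f \<xi> \<le> f \<xi>\<^sub>0"
    and mgf: "\<And>\<xi>. \<xi> < 0 \<Longrightarrow> (\<integral>\<^sup>+\<omega>. ennreal (exp (\<xi> * J \<omega>)) \<partial>M) \<le> ennreal (\<delta> * exp (\<xi> * f \<xi>))"
  shows "\<P>(\<omega> in M. J \<omega> \<le> (SUP \<xi>\<in>{..<0}. f \<xi>)) \<le> \<delta>"
proof -
  define \<kappa> where "\<kappa> = (SUP \<xi>\<in>{..<0}. f \<xi>)"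
  define R' where "R' = max R (- \<xi>\<^sub>0)"
  have *: "\<P>(\<omega> in M. J \<omega> \<le> \<kappa>) \<le> \<delta> * exp (R' * e)" if "e > 0" for e
  proof -
    obtain \<xi>' where \<xi>': "\<xi>' < 0" "\<kappa> - e < f \<xi>'"
      using bdd \<open>e > 0\<close> less_cSUP_iff[of "{..<0}" f "\<kappa> - e"] unfolding \<kappa>_def by auto
    \<comment> \<open>A near-maximiser left of \<open>- R\<close> is replaced by
      \<open>\<xi>\<^sub>0\<close>, whose value is at least as large. Either way the point lies in
      [-R', 0), which keeps the loss factor below exp (R' e).\<close>
    define \<xi> where "\<xi> = (if \<xi>' < - R then \<xi>\<^sub>0 else \<xi>')"
    have \<xi>: "\<xi> < 0" "- R' \<le> \<xi>" "\<kappa> - e < f \<xi>"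
      using \<xi>' tail(1) tail(2)[of \<xi>'] by (auto simp: \<xi>_def R'_def)
    have "emeasure M {\<omega>\<in>space M. J \<omega> \<le> \<kappa>}
        \<le> ennreal (exp (- \<xi> * \<kappa>)) * (\<integral>\<^sup>+\<omega>. ennreal (exp (- (- \<xi>) * J \<omega>)) * indicator (space M) \<omega> \<partial>M)"
      by (rule Chernoff_ineq_nn_integral_le) (use \<xi> in auto)
    also have "(\<integral>\<^sup>+\<omega>. ennreal (exp (- (- \<xi>) * J \<omega>)) * indicator (space M) \<omega> \<partial>M)
        = (\<integral>\<^sup>+\<omega>. ennreal (exp (\<xi> * J \<omega>)) \<partial>M)"
      by (rule nn_integral_cong) auto
    also have "ennreal (exp (- \<xi> * \<kappa>)) * \<dots> \<le> ennreal (exp (- \<xi> * \<kappa>)) * ennreal (\<delta> * exp (\<xi> * f \<xi>))"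
      by (intro mult_left_mono mgf \<xi>) auto
    also have "\<dots> = ennreal (\<delta> * exp (- \<xi> * (\<kappa> - f \<xi>)))"
      using \<open>0 \<le> \<delta>\<close> by (simp add: ennreal_mult'[symmetric] exp_diff exp_minus algebra_simps divide_inverse)
    also have "\<dots> \<le> ennreal (\<delta> * exp (R' * e))"
    proof -
      have "- \<xi> * (\<kappa> - f \<xi>) \<le> - \<xi> * e" using \<xi> by (intro mult_left_mono) auto
      also have "\<dots> \<le> R' * e" using \<xi> that by (intro mult_right_mono) auto
      finally show ?thesis using \<open>0 \<le> \<delta>\<close> by (intro ennreal_leI mult_left_mono) auto
    qed
    finally show ?thesis using \<open>0 \<le> \<delta>\<close> by (simp add: emeasure_eq_measure)
  qed
  have "((\<lambda>e. \<delta> * exp (R' * e)) \<longlongrightarrow> \<delta> * exp (R' * 0)) (at_right 0)"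
    by (intro tendsto_intros)
  then have "\<P>(\<omega> in M. J \<omega> \<le> \<kappa>) \<le> \<delta> * exp (R' * 0)"
    by (rule tendsto_lowerbound) (auto simp: eventually_at_right_less * intro: eventually_at_rightI[of 0 1])
  then show ?thesis by (simp add: \<kappa>_def)
qed

text \<open>\<open>f\<close> is chi with \<open>L\<close> for ln (eta / 2), which is negative. The
  first two bounds make the infimum and the supremum genuine; the third supplies the
  \<open>tail\<close> hypothesis of \<open>prob_le_SUP_le\<close>. The upper bound comes from ln (1
  + t) <= t.\<close>

lemma log_mgf_quotient_bounds:
  fixes a :: "'i \<Rightarrow> real" and L :: real
  assumes I: "finite I" "I \<noteq> {}" and a: "\<And>i. i \<in> I \<Longrightarrow> 0 < a i" and L: "L < 0"
  defines "f \<equiv> \<lambda>\<xi>. - (1 / \<xi>) * L - 1 / (2 * \<xi>) * (\<Sum>i\<in>I. ln (1 - 2 * \<xi> * a i))"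
  shows "0 < \<xi> \<Longrightarrow> (\<And>i. i \<in> I \<Longrightarrow> 2 * \<xi> * a i < 1) \<Longrightarrow> 0 \<le> f \<xi>"
    and "\<xi> < 0 \<Longrightarrow> f \<xi> \<le> (\<Sum>i\<in>I. a i)"
    and "\<exists>\<xi>\<^sub>0<0. \<exists>R. \<forall>\<xi>< - R. f \<xi> \<le> f \<xi>\<^sub>0"
proof -
  show "0 \<le> f \<xi>" if \<xi>: "0 < \<xi>" "\<And>i. i \<in> I \<Longrightarrow> 2 * \<xi> * a i < 1"
  proof -
    have "(\<Sum>i\<in>I. ln (1 - 2 * \<xi> * a i)) \<le> 0"
    proof (rule sum_nonpos)
      fix i assume "i \<in> I"
      then show "ln (1 - 2 * \<xi> * a i) \<le> 0" using \<xi>(2)[of i] \<xi>(1) a[of i] by simp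
    qed
    then have "L + (\<Sum>i\<in>I. ln (1 - 2 * \<xi> * a i)) / 2 \<le> 0" using L by simp
    then have "(L + (\<Sum>i\<in>I. ln (1 - 2 * \<xi> * a i)) / 2) / \<xi> \<le> 0"
      using \<xi>(1) by (intro divide_nonpos_pos)
    then show ?thesis by (simp add: f_def add_divide_distrib mult.commute)
  qed
  show "f \<xi> \<le> (\<Sum>i\<in>I. a i)" if \<xi>: "\<xi> < 0"
  proof -
    have "(\<Sum>i\<in>I. ln (1 - 2 * \<xi> * a i)) \<le> (\<Sum>i\<in>I. - 2 * \<xi> * a i)"
    proof (rule sum_mono)
      fix i assume "i \<in> I"
      then have "\<xi> * a i \<le> 0" using \<xi> a[of i] by (simp add: mult_nonpos_nonneg)
      then show "ln (1 - 2 * \<xi> * a i) \<le> - 2 * \<xi> * a i"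
        using ln_add_one_self_le_self[of "- 2 * \<xi> * a i"] by simp
    qed
    then have "L + (\<Sum>i\<in>I. ln (1 - 2 * \<xi> * a i)) / 2 \<le> - \<xi> * (\<Sum>i\<in>I. a i)"
      using L by (simp add: sum_distrib_left[symmetric] sum_negf)
    then have "- (L + (\<Sum>i\<in>I. ln (1 - 2 * \<xi> * a i)) / 2) / \<xi> \<le> (\<Sum>i\<in>I. a i)"
      using \<xi> by (simp add: field_simps)
    then show ?thesis by (simp add: f_def add_divide_distrib diff_divide_distrib mult.commute)
  qed
  \<comment> \<open>The substitution t = - xi turns the behaviour at minus infinity into a limit at
    \<open>at_top\<close>.\<close>
  define g where "g t = (L + (\<Sum>i\<in>I. ln (1 + 2 * t * a i)) / 2) / t" for t
  have fg: "f \<xi> = g (- \<xi>)" for \<xi> by (simp add: f_def g_def add_divide_distrib mult.commute)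
  have "((\<lambda>t. L / t + (\<Sum>i\<in>I. ln (1 + 2 * t * a i) / t) / 2) \<longlongrightarrow> 0 + (\<Sum>i\<in>I. 0) / 2) at_top"
  proof (intro tendsto_intros)
    fix i assume "i \<in> I"
    then have "a i > 0" by (rule a)
    then show "((\<lambda>t. ln (1 + 2 * t * a i) / t) \<longlongrightarrow> 0) at_top" by real_asymp
  qed (real_asymp | simp)+
  then have g0: "(g \<longlongrightarrow> 0) at_top"
    by (simp add: g_def[abs_def] add_divide_distrib sum_divide_distrib mult.commute)
  obtain i where i: "i \<in> I" using I by auto
  then have "a i > 0" by (rule a)
  \<comment> \<open>A single logarithm already outgrows the constant \<open>- L\<close>; the other
    summands are nonnegative, so \<open>g\<close> is positive at \<open>t0\<close>.\<close>
  then have "filterlim (\<lambda>t. L + ln (1 + 2 * t * a i) / 2) at_top at_top" by real_asymp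
  then have "eventually (\<lambda>t. L + ln (1 + 2 * t * a i) / 2 > 0 \<and> t > 0) at_top"
    by (intro eventually_conj) (auto simp: filterlim_at_top_dense eventually_gt_at_top)
  then obtain t0 where t0: "L + ln (1 + 2 * t0 * a i) / 2 > 0" "t0 > 0"
    using eventually_happens by (metis (mono_tags, lifting) trivial_limit_at_top_linorder)
  have "ln (1 + 2 * t0 * a i) \<le> (\<Sum>i\<in>I. ln (1 + 2 * t0 * a i))"
    by (rule member_le_sum) (use i I t0 a in \<open>auto intro!: ln_ge_zero simp: less_imp_le\<close>)
  then have "g t0 > 0" using t0 unfolding g_def by (intro divide_pos_pos) auto
  with g0 have "eventually (\<lambda>t. g t < g t0) at_top" by (rule order_tendstoD)
  then obtain R where "\<And>t. t > R \<Longrightarrow> g t < g t0" by (auto simp: eventually_at_top_dense)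
  then have "\<forall>\<xi>< - R. f \<xi> \<le> f (- t0)" by (auto simp: fg intro!: less_imp_le)
  then show "\<exists>\<xi>\<^sub>0<0. \<exists>R. \<forall>\<xi>< - R. f \<xi> \<le> f \<xi>\<^sub>0" using t0(2) by (intro exI[of _ "- t0"]) auto
qed

section \<open>Simultaneous diagonalisation\<close>

lemma upper_triangular_mult:
  fixes A B :: "'a :: semiring_0 mat"
  assumes "A \<in> carrier_mat n n" "B \<in> carrier_mat n n" "upper_triangular A" "upper_triangular B"
  shows "upper_triangular (A * B)"
proof
  fix i j assume ij: "j < i" "i < dim_row (A * B)"
  have "A $$ (i, l) * B $$ (l, j) = 0" if "l < n" for l
    using assms ij that upper_triangularD[of A l i] upper_triangularD[of B j l]
    by (cases "l < i") auto
  then show "(A * B) $$ (i, j) = 0"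
    using assms ij by (auto simp: scalar_prod_def intro!: sum.neutral)
qed

text \<open>The columns of \<open>T\<close> are the standard basis orthonormalised in the form of
  \<open>G\<close>. Column i combines only the basis vectors up to i, and it is orthogonal to the
  basis vectors before i. These two facts are the two triangularity claims, and together they keep a
  triangular matrix triangular in the new basis.\<close>

lemma pos_def_gram_schmidt:
  assumes G: "pos_def G" "G \<in> carrier_mat d d"
  obtains T where "T \<in> carrier_mat d d" "upper_triangular T" "upper_triangular (transpose_mat T * G)"
    "transpose_mat T * G * T = 1\<^sub>m d"
proof -
  define b where "b u v = (\<Sum>l<d. \<Sum>m<d. u l * G $$ (l, m) * v m)" for u v :: "nat \<Rightarrow> real"
  have G_sym: "G $$ (l, m) = G $$ (m, l)" if "l < d" "m < d" for l m
    using G that by (metis carrier_matD index_transpose_mat(1) pos_def_def)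
  have b_sym: "b u v = b v u" for u v
    unfolding b_def by (subst sum.swap) (auto intro!: sum.cong simp: G_sym mult_ac)
  have b_diff: "b (\<lambda>l. u l - v l) w = b u w - b v w" for u v w
    by (simp add: b_def algebra_simps sum_subtractf)
  have b_scale: "b (\<lambda>l. c * u l) w = c * b u w" for c u w
    by (simp add: b_def algebra_simps sum_distrib_left)
  have b_sum: "b (\<lambda>l. \<Sum>i<k. c i * q i l) w = (\<Sum>i<k. c i * b (q i) w)"
    for k :: nat and c :: "nat \<Rightarrow> real" and q w
  proof (induction k)
    case (Suc k)
    have "b (\<lambda>l. u l + v l) w = b u w + b v w" for u v
      by (simp add: b_def algebra_simps sum.distrib)
    with Suc show ?case by (simp add: b_scale)
  qed (simp add: b_def)
  have b_cong: "b u w = b v w" if "\<And>l. l < d \<Longrightarrow> u l = v l" for u v w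
    using that by (simp add: b_def)
  have b_pos: "b u u > 0" if "l < d" "u l \<noteq> 0" for u l
  proof -
    have "vec d u \<noteq> 0\<^sub>v d" using that by (metis index_vec index_zero_vec(1))
    then have "scalar_prod (vec d u) (G *\<^sub>v vec d u) > 0" using G by (auto simp: pos_def_def)
    also have "scalar_prod (vec d u) (G *\<^sub>v vec d u) = b u u"
      using G(2) by (auto simp: scalar_prod_def b_def sum_distrib_left mult_ac atLeast0LessThan intro!: sum.cong)
    finally show ?thesis .
  qed
  define e where "e k l = (if l = k then 1 else 0 :: real)" for k l :: nat
  \<comment> \<open>Orthonormality, triangular support, orthogonality to earlier basis vectors, and
    spanning. The span clause is what yields the third clause for the next vector.\<close>
  define gs where "gs k p \<longleftrightarrow>
      (\<forall>i<k. \<forall>j<k. b (p i) (p j) = (if i = j then 1 else 0)) \<and> (\<forall>i<k. \<forall>l. i < l \<longrightarrow> p i l = 0) \<and>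
      (\<forall>l. \<forall>i. l < i \<longrightarrow> i < k \<longrightarrow> b (p i) (e l) = 0) \<and>
      (\<forall>l<k. \<exists>c. \<forall>r<d. e l r = (\<Sum>i<k. c i * p i r))" for k p
  have gsD: "i < k \<Longrightarrow> j < k \<Longrightarrow> b (p i) (p j) = (if i = j then 1 else 0)"
    "i < k \<Longrightarrow> i < l \<Longrightarrow> p i l = 0" "l < i \<Longrightarrow> i < k \<Longrightarrow> b (p i) (e l) = 0"
    "l < k \<Longrightarrow> \<exists>c. \<forall>r<d. e l r = (\<Sum>i<k. c i * p i r)" if "gs k p" for k p i j l
    using that unfolding gs_def by blast+
  have "\<exists>p. gs k p" if "k \<le> d" for k
    using that
  proof (induction k)
    case (Suc k)
    then obtain p where "gs k p" by auto
    note p = gsD[OF this]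
    define w where "w l = e k l - (\<Sum>i<k. b (e k) (p i) * p i l)" for l
    have wp: "b w (p j) = 0" if "j < k" for j
    proof -
      have "b w (p j) = b (e k) (p j) - (\<Sum>i<k. b (e k) (p i) * b (p i) (p j))"
        unfolding w_def by (simp add: b_diff b_sum)
      also have "(\<Sum>i<k. b (e k) (p i) * b (p i) (p j)) = (\<Sum>i<k. if i = j then b (e k) (p i) else 0)"
        using that by (intro sum.cong) (auto simp: p)
      finally show ?thesis using that by simp
    qed
    \<comment> \<open>The earlier vectors vanish at index \<open>k\<close>, so subtracting
      projections leaves the entry 1. Hence \<open>w\<close> is nonzero and can be
      normalised.\<close>
    have "w k = 1" using p(2) by (simp add: w_def e_def)
    then have ww: "b w w > 0" using Suc by (intro b_pos[of k]) auto
    define n where "n = sqrt (b w w)"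
    have n: "n > 0" "n * n = b w w" using ww by (auto simp: n_def)
    define p' where "p' i = (if i = k then (\<lambda>l. 1 / n * w l) else p i)" for i
    have p'k: "b (p' k) u = 1 / n * b w u" for u
    proof -
      have "p' k = (\<lambda>l. 1 / n * w l)" by (simp add: p'_def)
      then show ?thesis by (simp only: b_scale)
    qed
    have *: "b (p' k) (p j) = 0" if "j < k" for j using wp[OF that] by (simp add: p'k)
    have "b (p' k) (p' k) = 1"
      using n ww by (simp add: p'k b_sym[of w "p' k"])
    then have 1: "b (p' i) (p' j) = (if i = j then 1 else 0)" if "i < Suc k" "j < Suc k" for i j
      using that p(1)[of i j] *[of i] *[of j] b_sym[of "p' i" "p' j"]
      by (auto simp: p'_def less_Suc_eq split: if_splits)
    have 2: "p' i l = 0" if "i < Suc k" "i < l" for i l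
      using that p(2) by (auto simp: p'_def w_def e_def less_Suc_eq)
    have 3: "b (p' i) (e l) = 0" if "l < i" "i < Suc k" for i l
    proof (cases "i = k")
      case True
      with p(4) that obtain c where c: "\<And>r. r < d \<Longrightarrow> e l r = (\<Sum>i<k. c i * p i r)" by blast
      have "b (e l) (p' k) = b (\<lambda>r. \<Sum>i<k. c i * p i r) (p' k)" by (rule b_cong) (rule c)
      also have "\<dots> = 0" using * by (simp add: b_sum b_sym[of _ "p' k"])
      finally show ?thesis using True by (simp add: b_sym)
    next
      case False
      then show ?thesis using that p(3) by (simp add: p'_def)
    qed
    have 4: "\<exists>c. \<forall>r<d. e l r = (\<Sum>i<Suc k. c i * p' i r)" if "l < Suc k" for l
    proof (cases "l = k")
      case True
      have "e k r = (\<Sum>i<Suc k. (if i = k then n else b (e k) (p i)) * p' i r)" for r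
        using n(1) by (simp add: p'_def w_def)
      then show ?thesis using True by (intro exI[of _ "\<lambda>i. if i = k then n else b (e k) (p i)"]) simp
    next
      case False
      with p(4) that obtain c where c: "\<And>r. r < d \<Longrightarrow> e l r = (\<Sum>i<k. c i * p i r)"
        by (metis less_Suc_eq)
      then have "\<forall>r<d. e l r = (\<Sum>i<Suc k. (c(k := 0)) i * p' i r)" by (simp add: p'_def)
      then show ?thesis by blast
    qed
    have "gs (Suc k) p'" unfolding gs_def using 1 2 3 4 by blast
    then show ?case by blast
  qed (auto simp: gs_def[abs_def])
  from this[of d] obtain p where "gs d p" by auto
  note p = gsD[OF this]
  define T where "T = mat d d (\<lambda>(l, i). p i l)"
  have T: "T \<in> carrier_mat d d" by (simp add: T_def)
  have TG: "(transpose_mat T * G) $$ (i, m) = (\<Sum>l<d. p i l * G $$ (l, m))" if "i < d" "m < d" for i m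
    using that G(2) by (simp add: T_def scalar_prod_def atLeast0LessThan)
  show thesis
  proof (rule that[OF T])
    show "upper_triangular T" using p(2) by (auto simp: T_def)
    show "upper_triangular (transpose_mat T * G)"
    proof
      fix i l assume "l < i" "i < dim_row (transpose_mat T * G)"
      then have il: "l < i" "i < d" by (auto simp: T_def)
      have "b (p i) (e l) = (\<Sum>l'<d. \<Sum>m<d. if m = l then p i l' * G $$ (l', m) else 0)"
        unfolding b_def e_def by (intro sum.cong) auto
      then show "(transpose_mat T * G) $$ (i, l) = 0" using il p(3)[OF il] TG[of i l] by simp
    qed
    show "transpose_mat T * G * T = 1\<^sub>m d"
    proof (rule eq_matI)
      fix i j assume "i < dim_row (1\<^sub>m d)" "j < dim_col (1\<^sub>m d)"
      then have ij: "i < d" "j < d" by auto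
      have "(transpose_mat T * G * T) $$ (i, j) = (\<Sum>m<d. (transpose_mat T * G) $$ (i, m) * p j m)"
        using ij G(2) T by (subst index_mult_mat) (auto simp: scalar_prod_def T_def atLeast0LessThan)
      also have "\<dots> = (\<Sum>m<d. \<Sum>l<d. p i l * G $$ (l, m) * p j m)"
        using ij by (simp add: TG sum_distrib_right)
      also have "\<dots> = b (p i) (p j)" unfolding b_def by (rule sum.swap)
      finally show "(transpose_mat T * G * T) $$ (i, j) = 1\<^sub>m d $$ (i, j)" using ij p(1) by simp
    qed (use T G in auto)
  qed
qed

text \<open>The form of the congruent matrix at u is the form of \<open>S\<close> at P u, and the
  left inverse \<open>R\<close> makes P injective.\<close>

lemma pos_def_congruence:
  fixes S P R :: "real mat"
  assumes S: "pos_def S" "S \<in> carrier_mat d d" and P: "P \<in> carrier_mat d d" "R * P = 1\<^sub>m d" "R \<in> carrier_mat d d"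
  shows "pos_def (transpose_mat P * S * P)"
  unfolding pos_def_def
proof (intro conjI ballI impI)
  have S': "transpose_mat S = S" using S by (simp add: pos_def_def)
  show "square_mat (transpose_mat P * S * P)" using P by auto
  show "transpose_mat (transpose_mat P * S * P) = transpose_mat P * S * P"
    using P S by (simp add: transpose_mult[of _ d d _ d] S' assoc_mult_mat[of _ d d _ d _ d] mult_carrier_mat[of _ d d _ d])
  fix u :: "real vec"
  assume u: "u \<in> carrier_vec (dim_row (transpose_mat P * S * P))"
    "u \<noteq> 0\<^sub>v (dim_row (transpose_mat P * S * P))"
  then have ud: "u \<in> carrier_vec d" "u \<noteq> 0\<^sub>v d" using P by auto
  have "P *\<^sub>v u \<noteq> 0\<^sub>v d"
  proof
    assume "P *\<^sub>v u = 0\<^sub>v d"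
    moreover have "R *\<^sub>v (P *\<^sub>v u) = u" using P ud by (simp add: assoc_mult_mat_vec[of _ d d _ d, symmetric])
    moreover have "R *\<^sub>v 0\<^sub>v d = 0\<^sub>v d" using P by auto
    ultimately show False using ud by simp
  qed
  then have "scalar_prod (P *\<^sub>v u) (S *\<^sub>v (P *\<^sub>v u)) > 0" using S P ud by (auto simp: pos_def_def)
  also have "scalar_prod (P *\<^sub>v u) (S *\<^sub>v (P *\<^sub>v u)) = scalar_prod u (transpose_mat P *\<^sub>v (S *\<^sub>v (P *\<^sub>v u)))"
    using transpose_vec_mult_scalar[of "transpose_mat P" d d "S *\<^sub>v (P *\<^sub>v u)" u] P S ud by simp
  also have "\<dots> = scalar_prod u ((transpose_mat P * S * P) *\<^sub>v u)"
    using P S ud by (simp add: assoc_mult_mat_vec[of _ d d _ d])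
  finally show "scalar_prod u ((transpose_mat P * S * P) *\<^sub>v u) > 0" .
qed

lemma proots_prod_list_linear:
  fixes as :: "'a :: idom list"
  shows "proots (\<Prod>a\<leftarrow>as. [:- a, 1:]) = mset as"
proof (induction as)
  case (Cons a as)
  have "(\<Prod>a\<leftarrow>as. [:- a, 1:]) \<noteq> 0" by (auto simp: prod_list_zero_iff)
  then have "proots ([:- a, 1:] * (\<Prod>a\<leftarrow>as. [:- a, 1:])) = {#a#} + mset as"
    using Cons by (subst proots_mult) (auto simp del: mult_pCons_left)
  then show ?case by simp
qed auto

text \<open>W S is self-adjoint for the inner product of \<open>S\<close>, because S W S is
  symmetric. Real Schur decomposition is available because the characteristic polynomial splits over
  the reals.\<close>

lemma pos_def_simultaneous_diagonalization:
  assumes W: "pos_def W" "W \<in> carrier_mat d d" and S: "pos_def S" "S \<in> carrier_mat d d"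
  obtains P a where "P \<in> carrier_mat d d" "transpose_mat P * S * P = 1\<^sub>m d"
    "W = P * mat_diag d a * transpose_mat P" "eigvals_mset (W * S) = image_mset a (mset_set {..<d})"
proof -
  let ?B = "W * S"
  have B: "?B \<in> carrier_mat d d" using W S by auto
  have sym: "transpose_mat S = S" "transpose_mat W = W" using W S by (auto simp: pos_def_def)
  obtain as where as: "char_poly ?B = (\<Prod>a\<leftarrow>as. [:- a, 1:])"
    using char_poly_pos_def_product[OF W S] by metis
  obtain U P0 Q0 where "schur_decomposition ?B as = (U, P0, Q0)" by (cases "schur_decomposition ?B as") auto
  from schur_decomposition[OF B as this] have U: "upper_triangular U" and sim: "similar_mat_wit ?B U P0 Q0"
    by auto
  note sim = similar_mat_witD2[OF B sim]
  note c[simp] = sim(5-7) W(2) S(2) mult_carrier_mat[of _ d d _ d] left_mult_one_mat[of _ d d] right_mult_one_mat[of _ d d]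
  note assoc = assoc_mult_mat[of _ d d _ d _ d]
  note tr = transpose_mult[of _ d d _ d]
  have BP0: "?B * P0 = P0 * U"
  proof -
    have "?B * P0 = P0 * U * (Q0 * P0)" unfolding sim(3) by (simp add: assoc del: sim(2))
    then show ?thesis by (simp add: sim(2) right_mult_one_mat[of _ d d])
  qed
  \<comment> \<open>Gram matrix of the Schur basis in the inner product of \<open>S\<close>;
    orthonormalising with respect to \<open>G\<close> leaves the invariant flag unchanged.\<close>
  define G where "G = transpose_mat P0 * S * P0"
  have G: "pos_def G" "G \<in> carrier_mat d d"
    unfolding G_def by (auto intro!: pos_def_congruence[OF S _ sim(2)] mult_carrier_mat[of _ d d])
  obtain T where T: "T \<in> carrier_mat d d" "upper_triangular T" "upper_triangular (transpose_mat T * G)"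
    "transpose_mat T * G * T = 1\<^sub>m d"
    using pos_def_gram_schmidt[OF G] by metis
  note c' [simp] = T(1) G(2)
  define P where "P = P0 * T"
  have P[simp]: "P \<in> carrier_mat d d" by (simp add: P_def)
  have orth: "transpose_mat P * S * P = 1\<^sub>m d"
    using T(4) by (simp add: P_def G_def tr assoc)
  \<comment> \<open>By \<open>orth\<close> the inverse of \<open>P\<close> is
    \<open>transpose_mat P * S\<close>, so \<open>D\<close> is W S expressed in the basis
    \<open>P\<close>.\<close>
  define D where "D = transpose_mat P * S * ?B * P"
  have D[simp]: "D \<in> carrier_mat d d" by (simp add: D_def)
  have "D = transpose_mat T * G * U * T"
    using arg_cong[OF BP0, of "\<lambda>X. transpose_mat P * S * X * T"] by (simp add: D_def P_def G_def tr assoc)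
  moreover have "upper_triangular (transpose_mat T * G * U * T)"
    by (intro upper_triangular_mult[of _ d] T U) auto
  ultimately have "upper_triangular D" by simp
  moreover have D_sym: "transpose_mat D = D"
    by (simp add: D_def tr assoc sym)
  ultimately have diag: "D $$ (i, j) = 0" if "i < d" "j < d" "i \<noteq> j" for i j
    using that D by (metis carrier_matD index_transpose_mat(1) linorder_neqE_nat upper_triangularD)
  define a where "a i = D $$ (i, i)" for i
  have Da: "D = mat_diag d a" by (rule eq_matI) (use carrier_matD[OF D] diag in \<open>auto simp: a_def mat_diag_def\<close>)
  \<comment> \<open>One-sided inverses of square matrices are two-sided. Thus P P^T is the inverse
    of \<open>S\<close>, which converts W S = P D P^T S into W = P D P^T.\<close>
  have SP: "S * P * transpose_mat P = 1\<^sub>m d"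
    by (rule mat_mult_left_right_inverse[of "transpose_mat P"]) (use orth in \<open>simp_all add: assoc\<close>)
  have PS: "P * (transpose_mat P * S) = 1\<^sub>m d"
    by (rule mat_mult_left_right_inverse[of "transpose_mat P * S"]) (use orth in \<open>simp_all\<close>)
  have PD: "P * D = ?B * P"
  proof -
    have "P * D = (P * (transpose_mat P * S)) * (?B * P)" by (simp add: D_def assoc)
    then show ?thesis by (simp add: PS)
  qed
  have "P * D * transpose_mat P = W * (S * P * transpose_mat P)" unfolding PD by (simp add: assoc)
  then have W_eq: "W = P * mat_diag d a * transpose_mat P" by (simp add: SP Da)
  have "similar_mat D ?B"
    unfolding similar_mat_def similar_mat_wit_def Let_def
  proof (intro exI conjI)
    show "D = transpose_mat P * S * ?B * P" by (rule D_def)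
    show "transpose_mat P * S * P = 1\<^sub>m (dim_row D)" using orth carrier_matD[OF D] by simp
    show "P * (transpose_mat P * S) = 1\<^sub>m (dim_row D)" using PS carrier_matD[OF D] by simp
    show "{D, ?B, transpose_mat P * S, P} \<subseteq> carrier_mat (dim_row D) (dim_row D)"
      using carrier_matD[OF D] by auto
  qed
  then have "char_poly ?B = (\<Prod>a\<leftarrow>diag_mat D. [:- a, 1:])"
    using char_poly_similar[of D ?B] char_poly_upper_triangular[OF D \<open>upper_triangular D\<close>] by simp
  then have "eigvals_mset ?B = mset (diag_mat D)"
    by (simp add: eigvals_mset_def proots_prod_list_linear)
  also have "\<dots> = image_mset a (mset_set {..<d})"
    using carrier_matD[OF D] by (simp add: diag_mat_def a_def[abs_def] atLeast0LessThan)
  finally show thesis by (rule that[OF P orth W_eq])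
qed

section \<open>The Lyapunov equation\<close>

lemma bij_betw_from_nat_into_UNIV:
  "bij_betw (from_nat_into (UNIV :: 'n::finite set)) {..<CARD('n)} UNIV"
  by (rule bij_betw_from_nat_into_finite) simp

lemma sum_from_nat_into_UNIV:
  "(\<Sum>i<CARD('n::finite). g (from_nat_into (UNIV :: 'n set) i)) = sum g UNIV"
  by (rule sum.reindex_bij_betw[OF bij_betw_from_nat_into_UNIV])

lemma from_nat_into_UNIV_eq_iff:
  "i < CARD('n::finite) \<Longrightarrow> j < CARD('n) \<Longrightarrow>
    from_nat_into (UNIV :: 'n set) i = from_nat_into UNIV j \<longleftrightarrow> i = j"
  using bij_betw_from_nat_into_UNIV[where 'n = 'n] by (auto simp: bij_betw_def inj_on_def)

text \<open>The new factor stands on the right, so that transposing puts \<open>transpose A\<close>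
  on the left and gives the orbit recursion \<open>y_Suc\<close> below.\<close>

primrec mat_power :: "real^'n^'n \<Rightarrow> nat \<Rightarrow> real^'n^'n" where
  "mat_power A 0 = Finite_Cartesian_Product.mat 1"
| "mat_power A (Suc k) = mat_power A k ** A"

text \<open>A spectral radius below 1 gives a uniform entry bound for the powers. Applying this
  after division by some \<open>r\<close> strictly between the spectral radius of \<open>A\<close>
  and 1 turns the bound into the decay c r^k.\<close>

lemma schur_stable_power_tendsto_0:
  fixes A :: "real^'n^'n"
  assumes "schur_stable A"
  shows "mat_power A \<longlonglongrightarrow> 0"
proof -
  let ?d = "CARD('n)" and ?C = "map_mat complex_of_real (to_mat A)"
  have C: "?C \<in> carrier_mat ?d ?d" by (simp add: to_mat_def)
  have d: "?d > 0" by simp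
  obtain z where z: "eigenvalue ?C z" "spectral_radius ?C = cmod z"
    using spectral_radius_mem_max(1)[OF C d] by (auto simp: spectrum_def)
  define \<rho> where "\<rho> = spectral_radius ?C"
  have \<rho>: "0 \<le> \<rho>" "\<rho> < 1" using z assms by (auto simp: \<rho>_def schur_stable_def)
  define r where "r = (\<rho> + 1) / 2"
  have r: "0 < r" "r < 1" "\<rho> < r" using \<rho> by (auto simp: r_def)
  define C' where "C' = complex_of_real (1 / r) \<cdot>\<^sub>m ?C"
  have C': "C' \<in> carrier_mat ?d ?d" using C by (simp add: C'_def)
  have "spectral_radius C' < 1"
  proof -
    obtain w where w: "eigenvalue C' w" "spectral_radius C' = cmod w"
      using spectral_radius_mem_max(1)[OF C' d] by (auto simp: spectrum_def)
    then obtain u where u: "u \<in> carrier_vec ?d" "u \<noteq> 0\<^sub>v ?d" "C' *\<^sub>v u = w \<cdot>\<^sub>v u"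
      using C' by (auto simp: eigenvalue_def eigenvector_def)
    have "?C *\<^sub>v u = complex_of_real r \<cdot>\<^sub>v (C' *\<^sub>v u)"
      using r C u(1) by (intro eq_vecI) (auto simp: C'_def scalar_prod_def sum_distrib_left intro!: sum.cong)
    then have "eigenvector ?C u (complex_of_real r * w)"
      using u C by (simp add: eigenvector_def smult_smult_assoc)
    then have "complex_of_real r * w \<in> spectrum ?C" by (auto simp: spectrum_def eigenvalue_def)
    then have "cmod (complex_of_real r * w) \<le> \<rho>"
      unfolding \<rho>_def by (intro spectral_radius_mem_max(2)[OF C d] imageI)
    then have "r * cmod w \<le> \<rho>" using r by (simp add: norm_mult)
    also have "\<dots> < r * 1" using r by simp
    finally show ?thesis using r w by (simp only: mult_less_cancel_left_pos)
  qed
  then obtain c where c: "\<And>k. norm_bound (C' ^\<^sub>m k) c"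
    using spectral_radius_jnf_norm_bound_less_1_upper_triangular[OF C'] by blast
  have entry: "(C' ^\<^sub>m k) $$ (i, j)
      = complex_of_real ((1 / r) ^ k * mat_power A k $ from_nat_into UNIV i $ from_nat_into UNIV j)"
    if "i < ?d" "j < ?d" for i j k
    using that
  proof (induction k arbitrary: i j)
    case 0
    then show ?case using C' by (simp add: Finite_Cartesian_Product.mat_def from_nat_into_UNIV_eq_iff)
  next
    case (Suc k)
    have "(C' ^\<^sub>m Suc k) $$ (i, j) = (\<Sum>l<?d. (C' ^\<^sub>m k) $$ (i, l) * C' $$ (l, j))"
      using Suc.prems C' pow_carrier_mat[OF C', of k] by (simp add: scalar_prod_def atLeast0LessThan)
    also have "\<dots> = (\<Sum>l<?d. complex_of_real ((1 / r) ^ Suc k *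
        (mat_power A k $ from_nat_into UNIV i $ from_nat_into UNIV l * A $ from_nat_into UNIV l $ from_nat_into UNIV j)))"
      using Suc by (intro sum.cong) (auto simp: C'_def to_mat_def)
    also have "\<dots> = complex_of_real (\<Sum>l<?d. (1 / r) ^ Suc k *
        (mat_power A k $ from_nat_into UNIV i $ from_nat_into UNIV l * A $ from_nat_into UNIV l $ from_nat_into UNIV j))"
      by simp
    also have "(\<Sum>l<?d. (1 / r) ^ Suc k *
        (mat_power A k $ from_nat_into UNIV i $ from_nat_into UNIV l * A $ from_nat_into UNIV l $ from_nat_into UNIV j))
      = (1 / r) ^ Suc k * mat_power A (Suc k) $ from_nat_into UNIV i $ from_nat_into UNIV j"
      by (subst sum_from_nat_into_UNIV) (simp add: matrix_matrix_mult_def sum_distrib_left)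
    finally show ?case .
  qed
  have bound: "\<bar>mat_power A k $ a $ b\<bar> \<le> c * r ^ k" for k a b
  proof -
    obtain i j where ij: "i < ?d" "j < ?d" "from_nat_into UNIV i = a" "from_nat_into UNIV j = b"
      using bij_betw_from_nat_into_UNIV[where 'n = 'n] unfolding bij_betw_def by (metis UNIV_I imageE lessThan_iff)
    have "norm ((C' ^\<^sub>m k) $$ (i, j)) \<le> c"
      using c[of k, unfolded norm_bound_def, rule_format, of i j] ij(1,2)
      by (simp only: carrier_matD[OF pow_carrier_mat[OF C', of k]])
    then have "(1 / r) ^ k * \<bar>mat_power A k $ a $ b\<bar> \<le> c"
      using r by (simp only: entry[OF ij(1,2)] ij norm_of_real abs_mult power_abs abs_of_pos zero_less_divide_1_iff zero_less_power)
    then show ?thesis using r by (simp add: power_divide field_simps)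
  qed
  show ?thesis
  proof (intro vec_tendstoI)
    fix a b
    have "(\<lambda>k. c * r ^ k) \<longlonglongrightarrow> c * 0" using r by (intro tendsto_intros LIMSEQ_power_zero) auto
    then have "(\<lambda>k. c * r ^ k) \<longlonglongrightarrow> 0" by simp
    then have "(\<lambda>k. mat_power A k $ a $ b) \<longlonglongrightarrow> 0"
      by (rule Lim_null_comparison[rotated]) (use bound in \<open>simp_all add: always_eventually\<close>)
    then show "(\<lambda>k. mat_power A k $ a $ b) \<longlonglongrightarrow> (0 :: real^'n^'n) $ a $ b" by simp
  qed
qed

text \<open>The equation paired with \<open>w\<close> on both sides: variance inherited from the
  previous state plus variance of the new noise.\<close>

lemma lyapunov_quadratic_form:
  fixes A X V :: "real^'n^'n"
  assumes "A ** X ** transpose A - X + V = 0"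
  shows "inner (transpose A *v w) (X *v (transpose A *v w)) + inner w (V *v w) = inner w (X *v w)"
proof -
  have "inner w ((A ** X ** transpose A - X + V) *v w) = 0" using assms by simp
  then show ?thesis
    by (simp add: matrix_vector_mult_add_rdistrib matrix_vector_mult_diff_rdistrib inner_add_right
        inner_diff_right dot_lmul_matrix[symmetric] matrix_vector_mul_assoc[symmetric] vector_transpose_matrix)
qed

text \<open>For \<open>s < 0\<close> the measure \<open>centred_normal s\<close> is the junk value \<open>N(0, \<bar>s\<bar>)\<close>, so Gaussianity of
  the initial state does not by itself make the quadratic form of \<open>X\<close> nonnegative.\<close>

lemma lyapunov_solution_nonneg:
  fixes A X V :: "real^'n^'n"
  assumes "schur_stable A" and lyap: "A ** X ** transpose A - X + V = 0"
    and V: "\<And>u. inner u (V *v u) \<ge> 0"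
  shows "inner u (X *v u) \<ge> 0"
proof -
  \<comment> \<open>Orbit of \<open>u\<close> under \<open>transpose A\<close>. By the Lyapunov
    equation the form of \<open>X\<close> drops at each step by the nonnegative form of
    \<open>V\<close>, and it tends to 0 since the orbit does; hence it starts nonnegative.\<close>
  define y where "y k = transpose (mat_power A k) *v u" for k
  define f where "f k = inner (y k) (X *v y k)" for k
  have y0: "y 0 = u" by (simp add: y_def)
  have y_Suc: "y (Suc k) = transpose A *v y k" for k
    by (simp only: y_def mat_power.simps matrix_transpose_mul matrix_vector_mul_assoc)
  have "f (Suc k) \<le> f k" for k
    using lyapunov_quadratic_form[OF lyap, of "y k"] V[of "y k"] by (simp add: f_def y_Suc)
  then have "decseq f" by (rule decseq_SucI)
  have y_lim: "y \<longlonglongrightarrow> 0"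
  proof (intro vec_tendstoI)
    fix i
    have "(\<lambda>k. \<Sum>j\<in>UNIV. mat_power A k $ j $ i * u $ j) \<longlonglongrightarrow> (\<Sum>j\<in>UNIV. (0 :: real^'n^'n) $ j $ i * u $ j)"
      by (intro tendsto_intros schur_stable_power_tendsto_0 assms)
    then show "(\<lambda>k. y k $ i) \<longlonglongrightarrow> 0 $ i"
      by (simp add: y_def matrix_vector_mult_def transpose_def)
  qed
  have "f \<longlonglongrightarrow> inner 0 (X *v 0)"
    unfolding f_def[abs_def]
    by (intro tendsto_inner y_lim bounded_linear.tendsto[OF matrix_vector_mul_bounded_linear])
  with \<open>decseq f\<close> have "0 \<le> f 0" by (metis decseq_ge inner_zero_left)
  then show ?thesis by (simp add: f_def y0)
qed

section \<open>The stationary process\<close>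

lemma (in prob_space) indep_set_mono:
  assumes "indep_set E F" "E' \<subseteq> E" "F' \<subseteq> F"
  shows "indep_set E' F'"
  using assms(1) unfolding indep_set_def
  by (rule indep_sets_mono_sets) (use assms(2,3) in \<open>auto split: bool.split\<close>)

lemma sum_lessThan_mult:
  fixes f :: "nat \<Rightarrow> 'b :: comm_monoid_add"
  shows "(\<Sum>i<m * n. f i) = (\<Sum>a<m. \<Sum>r<n. f (a * n + r))"
proof -
  have block: "sum f {k..<k + n} = (\<Sum>r<n. f (k + r))" for k
    using sum.shift_bounds_nat_ivl[of f 0 k n] by (simp add: atLeast0LessThan add.commute)
  have "(\<Sum>i<m * n. f i) = (\<Sum>a<m. sum f {a * n..<a * n + n})" by (rule sum.nat_group[symmetric])
  then show ?thesis by (simp only: block)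
qed

lemma inner_sum_axis:
  fixes y :: "real^'n"
  shows "inner (\<Sum>r<CARD('n). t r *\<^sub>R axis (from_nat_into UNIV r) 1) y
      = (\<Sum>r<CARD('n). t r * y $ from_nat_into UNIV r)"
  by (simp add: inner_sum_left inner_axis')

text \<open>Stability enters through \<open>X_nonneg\<close>, which the final proof obtains from
  \<open>lyapunov_solution_nonneg\<close>.\<close>

locale stationary_linear_system = prob_space M for M :: "'a measure" +
  fixes x v :: "nat \<Rightarrow> 'a \<Rightarrow> real^'n" and A V X :: "real^'n^'n"
  assumes V_nonneg: "inner u (V *v u) \<ge> 0" and X_nonneg: "inner u (X *v u) \<ge> 0"
    and lyapunov: "A ** X ** Finite_Cartesian_Product.transpose A - X + V = 0"
    and indep_noise: "indep_vars (\<lambda>_. borel) v UNIV"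
    and gaussian_noise: "centred_gaussian M (v j) V"
    and gaussian_init: "centred_gaussian M (x 0) X"
    and indep_init: "indep_set (sets (vimage_algebra (space M) (x 0) borel))
      (sets (vimage_algebra (space M) (\<lambda>\<omega> j. v j \<omega>) (Pi\<^sub>M UNIV (\<lambda>_. borel))))"
    and step: "\<omega> \<in> space M \<Longrightarrow> x (Suc j) \<omega> = A *v x j \<omega> + v j \<omega>"
begin

lemma noise_measurable[measurable]: "v j \<in> borel_measurable M"
  using gaussian_noise by (simp add: centred_gaussian_def)

lemma state_measurable[measurable]: "x j \<in> borel_measurable M"
proof (induction j)
  case 0
  show ?case using gaussian_init by (simp add: centred_gaussian_def)
next
  case (Suc j)
  have "(\<lambda>y. A *v y) \<in> borel_measurable borel"
    by (intro borel_measurable_continuous_onI matrix_vector_mult_linear_continuous_on)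
  then have "(\<lambda>\<omega>. A *v x j \<omega> + v j \<omega>) \<in> borel_measurable M"
    using Suc by (intro borel_measurable_add) (auto intro: measurable_compose)
  then show ?case by (subst measurable_cong[OF step]) auto
qed

text \<open>The two summands are measurable for the sigma-algebras of the initial state and of the
  whole noise sequence, so they inherit independence from \<open>indep_init\<close>.\<close>

lemma distr_initial_functional:
  "distr M borel (\<lambda>\<omega>. inner w (x 0 \<omega>) + (\<Sum>a<K. inner (c a) (v a \<omega>)))
    = centred_normal (inner w (X *v w) + (\<Sum>a<K. inner (c a) (V *v c a)))"
proof (rule centred_normal_add)
  let ?F = "vimage_algebra (space M) (x 0) borel"
  let ?G = "vimage_algebra (space M) (\<lambda>\<omega> j. v j \<omega>) (Pi\<^sub>M UNIV (\<lambda>_. borel))"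
  have "x 0 \<in> ?F \<rightarrow>\<^sub>M borel" by (rule measurable_vimage_algebra1) simp
  then have F: "(\<lambda>\<omega>. inner w (x 0 \<omega>)) \<in> ?F \<rightarrow>\<^sub>M borel" by simp
  have "(\<lambda>\<omega> j. v j \<omega>) \<in> ?G \<rightarrow>\<^sub>M Pi\<^sub>M UNIV (\<lambda>_. borel)"
    by (rule measurable_vimage_algebra1) (simp add: space_PiM)
  from measurable_compose[OF this measurable_component_singleton]
  have "v a \<in> ?G \<rightarrow>\<^sub>M borel" for a by simp
  then have G: "(\<lambda>\<omega>. \<Sum>a<K. inner (c a) (v a \<omega>)) \<in> ?G \<rightarrow>\<^sub>M borel" by simp
  show "indep_var borel (\<lambda>\<omega>. inner w (x 0 \<omega>)) borel (\<lambda>\<omega>. \<Sum>a<K. inner (c a) (v a \<omega>))"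
    unfolding indep_var_eq
  proof (intro conjI)
    show "indep_set
       (sigma_sets (space M) {(\<lambda>\<omega>. inner w (x 0 \<omega>)) -` A \<inter> space M |A. A \<in> sets borel})
       (sigma_sets (space M) {(\<lambda>\<omega>. \<Sum>a<K. inner (c a) (v a \<omega>)) -` A \<inter> space M |A. A \<in> sets borel})"
      unfolding sets_vimage_algebra[symmetric]
      by (rule indep_set_mono[OF indep_init]) (rule sets_image_in_sets; use F G in simp)+
  qed simp_all
  have "indep_vars (\<lambda>_. borel) (\<lambda>a \<omega>. inner (c a) (v a \<omega>)) {..<K}"
    by (rule indep_vars_compose2[where X = v and M' = "\<lambda>_. borel"])
      (auto intro: indep_vars_subset[OF indep_noise])
  then show "distr M borel (\<lambda>\<omega>. \<Sum>a<K. inner (c a) (v a \<omega>)) = centred_normal (\<Sum>a<K. inner (c a) (V *v c a))"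
    by (rule centred_normal_sum) (use gaussian_noise V_nonneg in \<open>auto simp: centred_gaussian_def\<close>)
  show "distr M borel (\<lambda>\<omega>. inner w (x 0 \<omega>)) = centred_normal (inner w (X *v w))"
    using gaussian_init by (simp add: centred_gaussian_def)
qed (use X_nonneg V_nonneg in \<open>auto intro: sum_nonneg\<close>)

lemma inner_step:
  "\<omega> \<in> space M \<Longrightarrow>
    inner w (x (Suc j) \<omega>) = inner (Finite_Cartesian_Product.transpose A *v w) (x j \<omega>) + inner w (v j \<omega>)"
  by (simp add: step inner_add_right dot_lmul_matrix[symmetric])

text \<open>One step of the recursion replaces \<open>w\<close> by \<open>transpose A *v w\<close> and adds the noise
  coefficient \<open>w\<close>; the Lyapunov equation says precisely that the variance is unchanged.\<close>

lemma distr_functional: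
  "distr M borel (\<lambda>\<omega>. inner w (x m \<omega>) + (\<Sum>a<K. inner (c a) (v (m + a) \<omega>)))
    = centred_normal (inner w (X *v w) + (\<Sum>a<K. inner (c a) (V *v c a)))"
\<comment> \<open>Each step back in time lengthens the noise sum by one term, so the coefficients
  and \<open>K\<close> have to vary.\<close>
proof (induction m arbitrary: w K c)
  case 0
  then show ?case using distr_initial_functional by simp
next
  case (Suc m)
  let ?w = "Finite_Cartesian_Product.transpose A *v w" and ?c = "case_nat w c"
  have "distr M borel (\<lambda>\<omega>. inner w (x (Suc m) \<omega>) + (\<Sum>a<K. inner (c a) (v (Suc m + a) \<omega>)))
      = distr M borel (\<lambda>\<omega>. inner ?w (x m \<omega>) + (\<Sum>a<Suc K. inner (?c a) (v (m + a) \<omega>)))"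
    by (rule distr_cong) (simp_all add: inner_step sum.lessThan_Suc_shift del: sum.lessThan_Suc)
  also have "\<dots> = centred_normal (inner ?w (X *v ?w) + (\<Sum>a<Suc K. inner (?c a) (V *v ?c a)))"
    by (rule Suc.IH)
  also have "inner ?w (X *v ?w) + (\<Sum>a<Suc K. inner (?c a) (V *v ?c a))
      = inner w (X *v w) + (\<Sum>a<K. inner (c a) (V *v c a))"
    using lyapunov_quadratic_form[OF lyapunov, of w]
    by (simp add: sum.lessThan_Suc_shift del: sum.lessThan_Suc)
  finally show ?case .
qed

text \<open>The order of quantifiers matters: the coefficients are independent of the starting time
  \<open>m\<close>, and stationarity of the window rests on this.\<close>

lemma window_functional:
  "\<exists>w c. \<forall>m. \<forall>\<omega>\<in>space M.
    (\<Sum>a<K. inner (u a) (x (m + a) \<omega>)) = inner w (x m \<omega>) + (\<Sum>a<K. inner (c a) (v (m + a) \<omega>))"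
proof (induction K arbitrary: u)
  case 0
  show ?case by (intro exI[of _ 0]) simp
next
  case (Suc K)
  from this[of "\<lambda>a. u (Suc a)"] obtain w c where wc: "\<And>m \<omega>. \<omega> \<in> space M \<Longrightarrow>
    (\<Sum>a<K. inner (u (Suc a)) (x (m + a) \<omega>)) = inner w (x m \<omega>) + (\<Sum>a<K. inner (c a) (v (m + a) \<omega>))"
    by blast
  have "(\<Sum>a<Suc K. inner (u a) (x (m + a) \<omega>))
      = inner (u 0 + Finite_Cartesian_Product.transpose A *v w) (x m \<omega>)
        + (\<Sum>a<Suc K. inner (case_nat w c a) (v (m + a) \<omega>))" if "\<omega> \<in> space M" for m \<omega>
    using wc[OF that, of "Suc m"] that
    by (simp add: sum.lessThan_Suc_shift inner_step inner_add_left del: sum.lessThan_Suc)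
  then show ?case by blast
qed

text \<open>One \<open>s\<close> serves all \<open>m\<close>, so it may be computed at m = 0, the
  window for which \<open>Sigma_mat\<close> is defined.\<close>

lemma distr_window_functional:
  "\<exists>s\<ge>0. \<forall>m. distr M borel (\<lambda>\<omega>. \<Sum>a<K. inner (u a) (x (m + a) \<omega>)) = centred_normal s"
proof -
  obtain w c where wc: "\<And>m \<omega>. \<omega> \<in> space M \<Longrightarrow>
    (\<Sum>a<K. inner (u a) (x (m + a) \<omega>)) = inner w (x m \<omega>) + (\<Sum>a<K. inner (c a) (v (m + a) \<omega>))"
    using window_functional[where K = K and u = u] by blast
  show ?thesis
  proof (intro exI conjI allI)
    show "inner w (X *v w) + (\<Sum>a<K. inner (c a) (V *v c a)) \<ge> 0"
      using X_nonneg V_nonneg by (intro add_nonneg_nonneg sum_nonneg)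
    fix m
    have "distr M borel (\<lambda>\<omega>. \<Sum>a<K. inner (u a) (x (m + a) \<omega>))
        = distr M borel (\<lambda>\<omega>. inner w (x m \<omega>) + (\<Sum>a<K. inner (c a) (v (m + a) \<omega>)))"
      by (rule distr_cong) (simp_all add: wc)
    then show "distr M borel (\<lambda>\<omega>. \<Sum>a<K. inner (u a) (x (m + a) \<omega>))
        = centred_normal (inner w (X *v w) + (\<Sum>a<K. inner (c a) (V *v c a)))"
      by (simp only: distr_functional)
  qed
qed

section \<open>The stacked window and its covariance matrix\<close>

lemma stacked_measurable[measurable]: "stacked (\<lambda>a. x (m + a)) i \<in> borel_measurable M"
proof -
  have "(\<lambda>y :: real^'n. y $ j) \<in> borel_measurable borel" for j
    by (intro borel_measurable_continuous_onI continuous_intros)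
  then show ?thesis
    unfolding stacked_def[abs_def] by (rule measurable_compose[OF state_measurable])
qed

lemma stacked_functional:
  "(\<Sum>i<K * CARD('n). t i * stacked (\<lambda>a. x (m + a)) i \<omega>)
    = (\<Sum>a<K. inner (\<Sum>r<CARD('n). t (a * CARD('n) + r) *\<^sub>R axis (from_nat_into UNIV r) 1) (x (m + a) \<omega>))"
  by (simp add: sum_lessThan_mult inner_sum_axis stacked_def)

lemma distr_stacked_functional:
  "distr M borel (\<lambda>\<omega>. \<Sum>i<K * CARD('n). t i * stacked (\<lambda>a. x (m + a)) i \<omega>)
    = centred_normal (\<Sum>i<K * CARD('n). \<Sum>j<K * CARD('n). t i * t j * Sigma_mat M K x $$ (i, j))"
proof -
  let ?d = "K * CARD('n)" and ?y = "stacked x"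
  have meas[measurable]: "?y i \<in> borel_measurable M" for i
    using stacked_measurable[of 0] by simp
  have law: "\<exists>s\<ge>0. \<forall>m. distr M borel (\<lambda>\<omega>. \<Sum>i<?d. t i * stacked (\<lambda>a. x (m + a)) i \<omega>) = centred_normal s" for t
    unfolding stacked_functional by (rule distr_window_functional)
  have moments: "integrable M (\<lambda>\<omega>. \<Sum>i<?d. t i * ?y i \<omega>)"
      "integrable M (\<lambda>\<omega>. (\<Sum>i<?d. t i * ?y i \<omega>)\<^sup>2)"
      "expectation (\<lambda>\<omega>. \<Sum>i<?d. t i * ?y i \<omega>) = 0"
      "expectation (\<lambda>\<omega>. (\<Sum>i<?d. t i * ?y i \<omega>)\<^sup>2) = s"
    if "s \<ge> 0" "distr M borel (\<lambda>\<omega>. \<Sum>i<?d. t i * ?y i \<omega>) = centred_normal s" for t s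
  proof -
    let ?Y = "\<lambda>\<omega>. \<Sum>i<?d. t i * ?y i \<omega>"
    have Y: "?Y \<in> M \<rightarrow>\<^sub>M borel" by simp
    have sq: "(\<lambda>y. y\<^sup>2) \<in> borel_measurable (borel :: real measure)" by simp
    have idm: "(\<lambda>y. y) \<in> borel_measurable (borel :: real measure)" by simp
    note mom = centred_normal_moments[OF that(1), folded that(2)]
    show "integrable M ?Y" using mom(1) unfolding integrable_distr_eq[OF Y idm] .
    show "expectation ?Y = 0" using mom(2) unfolding integral_distr[OF Y idm] .
    show "integrable M (\<lambda>\<omega>. (?Y \<omega>)\<^sup>2)" using mom(3) unfolding integrable_distr_eq[OF Y sq] .
    show "expectation (\<lambda>\<omega>. (?Y \<omega>)\<^sup>2) = s" using mom(4) unfolding integral_distr[OF Y sq] .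
  qed
  have law0: "\<exists>s\<ge>0. distr M borel (\<lambda>\<omega>. \<Sum>i<?d. t i * ?y i \<omega>) = centred_normal s" for t
  proof -
    obtain s where "s \<ge> 0" "\<And>m. distr M borel (\<lambda>\<omega>. \<Sum>i<?d. t i * stacked (\<lambda>a. x (m + a)) i \<omega>) = centred_normal s"
      using law[of t] by blast
    from this(1) this(2)[of 0] show ?thesis by auto
  qed
  \<comment> \<open>Unit coefficient vectors show each coordinate to be centred and square
    integrable. The covariances then become plain second moments, and the expectation of the squared
    sum may be expanded term by term.\<close>
  have single: "integrable M (?y i)" "integrable M (\<lambda>\<omega>. (?y i \<omega>)\<^sup>2)" "expectation (?y i) = 0"
    if "i < ?d" for i
  proof -
    obtain s where s: "s \<ge> 0"
      "distr M borel (\<lambda>\<omega>. \<Sum>j<?d. (if j = i then 1 else 0) * ?y j \<omega>) = centred_normal s"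
      using law0[of "\<lambda>j. if j = i then 1 else 0"] by blast
    have "(\<lambda>\<omega>. \<Sum>j<?d. (if j = i then 1 else 0) * ?y j \<omega>) = ?y i"
    proof
      fix \<omega>
      have "(\<Sum>j<?d. (if j = i then 1 else 0) * ?y j \<omega>) = (\<Sum>j<?d. if j = i then ?y j \<omega> else 0)"
        by (rule sum.cong) auto
      then show "(\<Sum>j<?d. (if j = i then 1 else 0) * ?y j \<omega>) = ?y i \<omega>" using that by simp
    qed
    then show "integrable M (?y i)" "integrable M (\<lambda>\<omega>. (?y i \<omega>)\<^sup>2)" "expectation (?y i) = 0"
      using moments(1-3)[OF s] by (simp_all add: fun_eq_iff)
  qed
  have prod: "integrable M (\<lambda>\<omega>. ?y i \<omega> * ?y j \<omega>)" if "i < ?d" "j < ?d" for i j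
  proof (rule Bochner_Integration.integrable_bound)
    show "integrable M (\<lambda>\<omega>. (?y i \<omega>)\<^sup>2 + (?y j \<omega>)\<^sup>2)" using single(2) that by simp
    have "\<bar>p * q\<bar> \<le> p\<^sup>2 + q\<^sup>2" for p q :: real
      using sum_squares_bound[of "\<bar>p\<bar>" "\<bar>q\<bar>"] mult_nonneg_nonneg[OF abs_ge_zero abs_ge_zero, of p q]
      unfolding abs_mult power2_abs by linarith
    then show "AE \<omega> in M. norm (?y i \<omega> * ?y j \<omega>) \<le> norm ((?y i \<omega>)\<^sup>2 + (?y j \<omega>)\<^sup>2)"
      by (simp add: abs_mult)
  qed simp
  have Sigma: "Sigma_mat M K x $$ (i, j) = expectation (\<lambda>\<omega>. ?y i \<omega> * ?y j \<omega>)" if "i < ?d" "j < ?d" for i j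
    using that single(3) by (simp add: Sigma_mat_def covariance_def)
  obtain s where s: "s \<ge> 0" and sm: "\<And>m. distr M borel (\<lambda>\<omega>. \<Sum>i<?d. t i * stacked (\<lambda>a. x (m + a)) i \<omega>) = centred_normal s"
    using law[of t] by blast
  have "s = expectation (\<lambda>\<omega>. (\<Sum>i<?d. t i * ?y i \<omega>)\<^sup>2)"
    by (rule moments(4)[symmetric]) (use s sm[of 0] in simp_all)
  also have "\<dots> = expectation (\<lambda>\<omega>. \<Sum>i<?d. \<Sum>j<?d. t i * t j * (?y i \<omega> * ?y j \<omega>))"
    by (simp add: power2_eq_square sum_product mult_ac)
  also have "\<dots> = (\<Sum>i<?d. \<Sum>j<?d. t i * t j * expectation (\<lambda>\<omega>. ?y i \<omega> * ?y j \<omega>))"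
    by (subst Bochner_Integration.integral_sum; (intro Bochner_Integration.integrable_sum sum.cong refl)?)+
      (use prod in auto)
  also have "\<dots> = (\<Sum>i<?d. \<Sum>j<?d. t i * t j * Sigma_mat M K x $$ (i, j))"
    by (intro sum.cong refl) (simp add: Sigma)
  finally show ?thesis using sm by simp
qed

end

section \<open>The cost as a quadratic form\<close>

lemma Omega_mat_carrier: "Omega_mat N (Q :: real^'n^'n) \<in> carrier_mat (N * CARD('n)) (N * CARD('n))"
  by (rule carrier_matI) (simp_all add: Omega_mat_def dim_diag_block_mat to_mat_def map_replicate sum_list_replicate)

text \<open>\<open>diag_block_mat\<close> splits off the first block, so the induction on
  \<open>N\<close> lowers both block indices by one.\<close>

lemma Omega_mat_entry:
  fixes Q :: "real^'n^'n"
  assumes "a < N" "b < N" "r < CARD('n)" "s < CARD('n)"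
  shows "Omega_mat N Q $$ (a * CARD('n) + r, b * CARD('n) + s)
    = (if a = b then Q $ from_nat_into UNIV r $ from_nat_into UNIV s else 0)"
  using assms
proof (induction N arbitrary: a b)
  case (Suc N)
  let ?n = "CARD('n)" and ?i = "a * CARD('n) + r" and ?j = "b * CARD('n) + s"
  have dims: "dim_row (Omega_mat N Q) = N * ?n" "dim_col (Omega_mat N Q) = N * ?n"
    "dim_row (to_mat Q) = ?n" "dim_col (to_mat Q) = ?n"
    using Omega_mat_carrier[of N Q] by (auto simp: to_mat_def)
  have Omega: "Omega_mat (Suc N) Q = four_block_mat (to_mat Q) (0\<^sub>m ?n (N * ?n)) (0\<^sub>m (N * ?n) ?n) (Omega_mat N Q)"
    unfolding Omega_mat_def replicate_Suc diag_block_mat.simps Let_def using dims by (simp add: Omega_mat_def)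
  have bound: "c * ?n + q < ?n + N * ?n" if "c < Suc N" "q < ?n" for c q
  proof -
    have "c * ?n \<le> N * ?n" using that by (intro mult_right_mono) auto
    then show ?thesis using that(2) by linarith
  qed
  have "Omega_mat (Suc N) Q $$ (?i, ?j) =
      (if ?i < ?n then if ?j < ?n then to_mat Q $$ (?i, ?j) else 0
       else if ?j < ?n then 0 else Omega_mat N Q $$ (?i - ?n, ?j - ?n))"
    unfolding Omega using bound[of a r] bound[of b s] Suc.prems
    by (subst index_mat_four_block) (auto simp: dims)
  then show ?case
    using Suc.prems Suc.IH[of "a - 1" "b - 1"] by (cases a; cases b) (auto simp: to_mat_def)
qed simp

text \<open>Stated for an arbitrary blockwise match of \<open>y\<close> and \<open>z\<close>, so
  that it serves both the random window and the test vectors for positive definiteness.\<close>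

lemma Omega_mat_quadratic_form:
  fixes Q :: "real^'n^'n" and z :: "nat \<Rightarrow> real^'n"
  assumes "\<And>a r. a < N \<Longrightarrow> r < CARD('n) \<Longrightarrow> y (a * CARD('n) + r) = z a $ from_nat_into UNIV r"
  shows "(\<Sum>i<N * CARD('n). \<Sum>j<N * CARD('n). y i * Omega_mat N Q $$ (i, j) * y j)
    = (\<Sum>a<N. inner (z a) (Q *v z a))"
proof -
  let ?n = "CARD('n)" and ?e = "from_nat_into (UNIV :: 'n set)"
  have "(\<Sum>i<N * ?n. \<Sum>j<N * ?n. y i * Omega_mat N Q $$ (i, j) * y j)
      = (\<Sum>a<N. \<Sum>r<?n. \<Sum>b<N. \<Sum>s<?n. if a = b then z a $ ?e r * Q $ ?e r $ ?e s * z a $ ?e s else 0)"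
    unfolding sum_lessThan_mult by (intro sum.cong refl) (auto simp: assms Omega_mat_entry)
  also have "\<dots> = (\<Sum>a<N. \<Sum>r<?n. \<Sum>b<N. if a = b then \<Sum>s<?n. z a $ ?e r * Q $ ?e r $ ?e s * z a $ ?e s else 0)"
    by (intro sum.cong refl) simp
  also have "\<dots> = (\<Sum>a<N. \<Sum>r<?n. z a $ ?e r * (\<Sum>s<?n. Q $ ?e r $ ?e s * z a $ ?e s))"
    by (simp add: sum_distrib_left mult_ac)
  also have "\<dots> = (\<Sum>a<N. inner (z a) (Q *v z a))"
    by (simp add: sum_from_nat_into_UNIV[where g = "\<lambda>s. Q $ _ $ s * z _ $ s"]
        sum_from_nat_into_UNIV[where g = "\<lambda>r. z _ $ r * (\<Sum>s\<in>UNIV. Q $ r $ s * z _ $ s)"]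
        inner_vec_def matrix_vector_mult_def)
  finally show ?thesis .
qed

lemma pos_def_Omega_mat:
  fixes Q :: "real^'n^'n"
  assumes sym: "Finite_Cartesian_Product.transpose Q = Q" and pos: "\<And>u. u \<noteq> 0 \<Longrightarrow> inner u (Q *v u) > 0"
  shows "pos_def (Omega_mat N Q)"
  unfolding pos_def_def
proof (intro conjI ballI impI)
  let ?n = "CARD('n)" and ?e = "from_nat_into (UNIV :: 'n set)"
  note C = Omega_mat_carrier[of N Q]
  have split: "\<exists>a r. i = a * ?n + r \<and> a < N \<and> r < ?n" if "i < N * ?n" for i
    using that by (intro exI[of _ "i div ?n"] exI[of _ "i mod ?n"]) (simp add: less_mult_imp_div_less)
  show "square_mat (Omega_mat N Q)" using C by auto
  have Q_sym: "Q $ p $ q = Q $ q $ p" for p q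
    using arg_cong[OF sym, of "\<lambda>B. B $ p $ q"] by (simp add: Finite_Cartesian_Product.transpose_def)
  have entry: "Omega_mat N Q $$ (j, i) = Omega_mat N Q $$ (i, j)" if "i < N * ?n" "j < N * ?n" for i j
    using split[OF that(1)] split[OF that(2)] Q_sym by (auto simp: Omega_mat_entry)
  show "transpose_mat (Omega_mat N Q) = Omega_mat N Q"
    by (rule eq_matI) (use entry C in auto)
  fix u :: "real Matrix.vec"
  assume u: "u \<in> carrier_vec (dim_row (Omega_mat N Q))" "u \<noteq> 0\<^sub>v (dim_row (Omega_mat N Q))"
  \<comment> \<open>Block \<open>a\<close> of \<open>u\<close> as an element of
    \<open>real^'n\<close>; a nonzero entry of \<open>u\<close> makes its block nonzero.\<close>
  define z where "z a = (\<Sum>r<?n. vec_index u (a * ?n + r) *\<^sub>R axis (?e r) (1 :: real))" for a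
  have z: "z a $ ?e s = vec_index u (a * ?n + s)" if "s < ?n" for a s
  proof -
    have "z a $ ?e s = (\<Sum>r<?n. if r = s then vec_index u (a * ?n + r) else 0)"
      unfolding z_def sum_component using that
      by (intro sum.cong) (auto simp: axis_def from_nat_into_UNIV_eq_iff)
    then show ?thesis using that by simp
  qed
  have nonneg: "inner w (Q *v w) \<ge> 0" for w using pos[of w] by (cases "w = 0") auto
  obtain i where i: "i < N * ?n" "vec_index u i \<noteq> 0"
    using u C by (metis carrier_matD(1) carrier_vecD eq_vecI index_zero_vec)
  obtain a r where ar: "i = a * ?n + r" "a < N" "r < ?n" using split[OF i(1)] by blast
  then have "z a \<noteq> 0" using z[of r a] i by auto
  then have "(\<Sum>a<N. inner (z a) (Q *v z a)) > 0"
    using ar nonneg by (intro sum_pos2[of _ a]) (auto intro: pos)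
  also have "(\<Sum>a<N. inner (z a) (Q *v z a))
      = (\<Sum>i<N * ?n. \<Sum>j<N * ?n. vec_index u i * Omega_mat N Q $$ (i, j) * vec_index u j)"
    by (rule Omega_mat_quadratic_form[symmetric]) (simp add: z)
  also have "\<dots> = scalar_prod u (Omega_mat N Q *\<^sub>v u)"
    using C u by (auto simp: scalar_prod_def sum_distrib_left atLeast0LessThan mult_ac intro!: sum.cong)
  finally show "scalar_prod u (Omega_mat N Q *\<^sub>v u) > 0" .
qed

text \<open>Entrywise form, because the law of the window and the cost are written as finite
  sums.\<close>

lemma pos_def_simultaneous_diagonalization_entries:
  assumes W: "pos_def W" "W \<in> carrier_mat d d" and S: "pos_def S" "S \<in> carrier_mat d d"
  shows "\<exists>p a. (\<forall>j<d. \<forall>j'<d.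
        (\<Sum>i<d. \<Sum>i'<d. p i j * p i' j' * S $$ (i, i')) = (if j = j' then 1 else 0)) \<and>
      (\<forall>i<d. \<forall>i'<d. W $$ (i, i') = (\<Sum>j<d. a j * p i j * p i' j)) \<and>
      eigvals_mset (W * S) = image_mset a (mset_set {..<d})"
proof -
  obtain P a where P: "P \<in> carrier_mat d d" and orth: "transpose_mat P * S * P = 1\<^sub>m d"
    and W_eq: "W = P * mat_diag d a * transpose_mat P"
    and ev: "eigvals_mset (W * S) = image_mset a (mset_set {..<d})"
    using pos_def_simultaneous_diagonalization[OF W S] by metis
  show ?thesis
  proof (intro exI[of _ "\<lambda>i j. P $$ (i, j)"] exI[of _ a] conjI allI impI)
    fix j j' assume j: "j < d" "j' < d"
    have PS: "(transpose_mat P * S) $$ (j, i') = (\<Sum>i<d. P $$ (i, j) * S $$ (i, i'))" if "i' < d" for i'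
      using P S j that by (simp add: scalar_prod_def atLeast0LessThan)
    have "(transpose_mat P * S * P) $$ (j, j') = (\<Sum>i'<d. (transpose_mat P * S) $$ (j, i') * P $$ (i', j'))"
      using P S j by (subst index_mult_mat) (simp_all add: scalar_prod_def atLeast0LessThan)
    also have "\<dots> = (\<Sum>i'<d. \<Sum>i<d. P $$ (i, j) * P $$ (i', j') * S $$ (i, i'))"
      by (simp add: PS sum_distrib_left sum_distrib_right mult_ac)
    also have "\<dots> = (\<Sum>i<d. \<Sum>i'<d. P $$ (i, j) * P $$ (i', j') * S $$ (i, i'))" by (rule sum.swap)
    finally show "(\<Sum>i<d. \<Sum>i'<d. P $$ (i, j) * P $$ (i', j') * S $$ (i, i')) = (if j = j' then 1 else 0)"
      using orth j by simp
  next
    fix i i' assume i: "i < d" "i' < d"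
    then have "W $$ (i, i') = (\<Sum>j<d. P $$ (i, j) * a j * P $$ (i', j))"
      unfolding W_eq mat_diag_mult_right[OF P] using P
      by (subst index_mult_mat) (simp_all add: scalar_prod_def atLeast0LessThan)
    then show "W $$ (i, i') = (\<Sum>j<d. a j * P $$ (i, j) * P $$ (i', j))" by (simp add: mult_ac)
  qed (rule ev)
qed

text \<open>This is the origin of chi: it is the threshold at which Chernoff's bound, exp (- xi
  kappa) times the exponential moment, equals exactly \<open>\<delta>\<close>.\<close>

lemma exp_log_mgf_quotient:
  assumes I: "finite I" and p: "\<And>i. i \<in> I \<Longrightarrow> 0 < (p i :: real)" and "\<xi> \<noteq> 0" "0 < \<delta>"
  shows "\<delta> * exp (\<xi> * (- (1 / \<xi>) * ln \<delta> - 1 / (2 * \<xi>) * (\<Sum>i\<in>I. ln (p i)))) = (\<Prod>i\<in>I. 1 / sqrt (p i))"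
proof -
  have "\<xi> * (- (1 / \<xi>) * ln \<delta> - 1 / (2 * \<xi>) * (\<Sum>i\<in>I. ln (p i))) = - ln \<delta> + (\<Sum>i\<in>I. - ln (sqrt (p i)))"
  proof -
    have "(\<Sum>i\<in>I. - ln (sqrt (p i))) = (\<Sum>i\<in>I. - (ln (p i) / 2))"
      using p by (intro sum.cong refl) (simp add: ln_sqrt less_imp_le)
    then show ?thesis using \<open>\<xi> \<noteq> 0\<close> by (simp add: field_simps sum_negf sum_divide_distrib[symmetric])
  qed
  also have "exp \<dots> = (1 / \<delta>) * (\<Prod>i\<in>I. exp (- ln (sqrt (p i))))"
    unfolding exp_add exp_sum[OF I] using \<open>0 < \<delta>\<close> by (simp add: exp_minus inverse_eq_divide)
  also have "(\<Prod>i\<in>I. exp (- ln (sqrt (p i)))) = (\<Prod>i\<in>I. 1 / sqrt (p i))"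
    using p by (intro prod.cong refl) (simp add: exp_minus inverse_eq_divide)
  finally show ?thesis using \<open>0 < \<delta>\<close> by simp
qed

section \<open>The two-sided tail bound for the diagonalised form and for the cost\<close>

lemma (in prob_space) prob_quadratic_form_notin_interval:
  fixes z :: "nat \<Rightarrow> 'a \<Rightarrow> real"
  assumes W: "pos_def W" "W \<in> carrier_mat d d" and S: "pos_def S" "S \<in> carrier_mat d d"
    and d: "d > 0" and \<eta>: "0 < \<eta>" "\<eta> < 1"
    and ev: "eigvals_mset (W * S) = image_mset a (mset_set {..<d})"
    and z[measurable]: "\<And>i. i < d \<Longrightarrow> z i \<in> borel_measurable M"
    and law: "\<And>t. distr M borel (\<lambda>\<omega>. \<Sum>i<d. t i * z i \<omega>) = centred_normal (\<Sum>i<d. (t i)\<^sup>2)"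
  shows "\<P>(\<omega> in M. (\<Sum>i<d. a i * (z i \<omega>)\<^sup>2) \<notin> {kappa_minus \<eta> (W * S)<..<kappa_plus \<eta> (W * S)}) \<le> \<eta>"
proof -
  define J where "J \<omega> = (\<Sum>i<d. a i * (z i \<omega>)\<^sup>2)" for \<omega>
  have J[measurable]: "J \<in> borel_measurable M" unfolding J_def[abs_def] by measurable
  let ?f = "chi \<eta> (W * S)" and ?\<delta> = "\<eta> / 2" and ?R = "1 / (2 * lambda_max (W * S))"
  have a: "a i > 0" if "i < d" for i using eigvals_pos[OF W S, of "a i"] that by (simp add: ev)
  have a_le: "a i \<le> lambda_max (W * S)" if "i < d" for i using that by (simp add: lambda_max_def ev)
  have lam: "lambda_max (W * S) > 0" using a_le[OF d] a[OF d] by simp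
  \<comment> \<open>The interval for xi is exactly the range in which every factor 1 - 2 xi a_i
    stays positive, so that the exponential moment is finite.\<close>
  have small: "2 * \<xi> * a i < 1" if "0 < \<xi>" "\<xi> < ?R" "i < d" for \<xi> i
  proof -
    have "2 * \<xi> * a i \<le> 2 * \<xi> * lambda_max (W * S)" using that a_le by (intro mult_left_mono) auto
    also have "\<dots> < 1" using that lam by (simp add: field_simps)
    finally show ?thesis .
  qed
  have chi: "?f \<xi> = - (1 / \<xi>) * ln ?\<delta> - 1 / (2 * \<xi>) * (\<Sum>i<d. ln (1 - 2 * \<xi> * a i))"
    if "\<xi> < 0 \<or> 0 < \<xi> \<and> \<xi> < ?R" for \<xi>
    using chi_eq_sum[OF W S that, of \<eta>] by (simp add: ev sum_unfold_sum_mset image_mset.compositionality o_def)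
  have ln\<delta>: "ln ?\<delta> < 0" using \<eta> by simp
  note bounds = log_mgf_quotient_bounds[of "{..<d}" a "ln ?\<delta>"]
  have ne: "finite {..<d}" "{..<d} \<noteq> {}" using d by auto
  have "\<P>(\<omega> in M. J \<omega> \<ge> (INF \<xi>\<in>{0<..<?R}. ?f \<xi>)) \<le> ?\<delta>"
  proof (rule prob_ge_INF_le[OF J])
    show "bdd_below (?f ` {0<..<?R})"
      by (rule bdd_belowI2[where m = 0]) (use bounds(1)[OF ne _ ln\<delta>] a small chi in auto)
    fix \<xi> assume \<xi>: "0 < \<xi>" "\<xi> < ?R"
    have "(\<integral>\<^sup>+\<omega>. ennreal (exp (\<xi> * J \<omega>)) \<partial>M) = (\<integral>\<^sup>+\<omega>. ennreal (exp (\<Sum>i<d. (\<xi> * a i) * (z i \<omega>)\<^sup>2)) \<partial>M)"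
      by (simp add: J_def sum_distrib_left mult.assoc)
    also have "\<dots> = ennreal (\<Prod>i<d. 1 / sqrt (1 - 2 * (\<xi> * a i)))"
      by (rule nn_integral_exp_sum_squares[OF _ z law]) (use \<xi> a small in \<open>auto simp: mult.assoc less_imp_le\<close>)
    also have "(\<Prod>i<d. 1 / sqrt (1 - 2 * (\<xi> * a i))) = ?\<delta> * exp (\<xi> * ?f \<xi>)"
      unfolding chi[OF disjI2[OF conjI[OF \<xi>]]]
      by (subst exp_log_mgf_quotient) (use \<xi> small \<eta> in \<open>auto simp: mult.assoc\<close>)
    finally show "(\<integral>\<^sup>+\<omega>. ennreal (exp (\<xi> * J \<omega>)) \<partial>M) \<le> ennreal (?\<delta> * exp (\<xi> * ?f \<xi>))" by simp
  qed (use lam \<eta> in auto)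
  then have upper: "\<P>(\<omega> in M. J \<omega> \<ge> kappa_plus \<eta> (W * S)) \<le> ?\<delta>" by (simp add: kappa_plus_def)
  have "\<exists>\<xi>\<^sub>0<0. \<exists>R. \<forall>\<xi>< - R. ?f \<xi> \<le> ?f \<xi>\<^sub>0"
  proof -
    obtain \<xi>\<^sub>0 R where *: "\<xi>\<^sub>0 < 0" "\<And>\<xi>. \<xi> < - R \<Longrightarrow>
      - (1 / \<xi>) * ln ?\<delta> - 1 / (2 * \<xi>) * (\<Sum>i<d. ln (1 - 2 * \<xi> * a i))
      \<le> - (1 / \<xi>\<^sub>0) * ln ?\<delta> - 1 / (2 * \<xi>\<^sub>0) * (\<Sum>i<d. ln (1 - 2 * \<xi>\<^sub>0 * a i))"
      using bounds(3)[OF ne _ ln\<delta>] a by auto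
    \<comment> \<open>The given \<open>R\<close> may be negative; the maximum with 0 confines xi to
      the negative axis, where the sum formula for chi holds.\<close>
    have "?f \<xi> \<le> ?f \<xi>\<^sub>0" if "\<xi> < - max R 0" for \<xi>
    proof -
      have "\<xi> < - R" "\<xi> < 0" using that by auto
      then show ?thesis using *(2)[of \<xi>] *(1) by (simp only: chi[OF disjI1])
    qed
    then show ?thesis using *(1) by blast
  qed
  then obtain \<xi>\<^sub>0 R where tail: "\<xi>\<^sub>0 < 0" "\<And>\<xi>. \<xi> < - R \<Longrightarrow> ?f \<xi> \<le> ?f \<xi>\<^sub>0" by blast
  have "\<P>(\<omega> in M. J \<omega> \<le> (SUP \<xi>\<in>{..<0}. ?f \<xi>)) \<le> ?\<delta>"
  proof (rule prob_le_SUP_le[where f = ?f, OF J _ _ tail])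
    show "bdd_above (?f ` {..<0})"
      by (rule bdd_aboveI2[where M = "\<Sum>i<d. a i"]) (use bounds(2)[OF ne _ ln\<delta>] a chi in auto)
    fix \<xi> :: real assume \<xi>: "\<xi> < 0"
    have b: "0 \<le> - \<xi> * a i" if "i < d" for i using \<xi> a[OF that] by (simp add: mult_nonpos_nonneg)
    have eq: "exp (\<xi> * J \<omega>) = exp (- (\<Sum>i<d. (- \<xi> * a i) * (z i \<omega>)\<^sup>2))" for \<omega>
      by (simp add: J_def sum_distrib_left mult.assoc sum_negf)
    have "\<xi> * J \<omega> \<le> 0" for \<omega>
      unfolding J_def using \<xi> a by (intro mult_nonpos_nonneg sum_nonneg mult_nonneg_nonneg) (auto simp: less_imp_le)
    then have "integrable M (\<lambda>\<omega>. exp (\<xi> * J \<omega>))"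
      by (intro integrable_const_bound[where B = 1]) auto
    then have "(\<integral>\<^sup>+\<omega>. ennreal (exp (\<xi> * J \<omega>)) \<partial>M) = ennreal (\<integral>\<omega>. exp (\<xi> * J \<omega>) \<partial>M)"
      by (rule nn_integral_eq_integral) simp
    also have "(\<integral>\<omega>. exp (\<xi> * J \<omega>) \<partial>M) = (\<Prod>i<d. 1 / sqrt (1 + 2 * (- \<xi> * a i)))"
      unfolding eq by (rule integral_exp_neg_sum_squares[OF _ z law]) (use b in auto)
    also have "\<dots> = (\<Prod>i<d. 1 / sqrt (1 - 2 * \<xi> * a i))" by (simp add: mult.assoc)
    also have "\<dots> = ?\<delta> * exp (\<xi> * ?f \<xi>)"
      unfolding chi[OF disjI1[OF \<xi>]]
    proof (rule exp_log_mgf_quotient[symmetric])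
      show "0 < 1 - 2 * \<xi> * a i" if "i \<in> {..<d}" for i using b[of i] that by simp
    qed (use \<xi> \<eta> in auto)
    finally show "(\<integral>\<^sup>+\<omega>. ennreal (exp (\<xi> * J \<omega>)) \<partial>M) \<le> ennreal (?\<delta> * exp (\<xi> * ?f \<xi>))" by simp
  qed (use \<eta> in auto)
  then have lower: "\<P>(\<omega> in M. J \<omega> \<le> kappa_minus \<eta> (W * S)) \<le> ?\<delta>" by (simp add: kappa_minus_def)
  \<comment> \<open>The inclusion in the two tail events holds whichever way the two thresholds are
    ordered, so a possibly empty interval needs no case of its own.\<close>
  have "\<P>(\<omega> in M. J \<omega> \<notin> {kappa_minus \<eta> (W * S)<..<kappa_plus \<eta> (W * S)})
      \<le> prob ({\<omega>\<in>space M. J \<omega> \<ge> kappa_plus \<eta> (W * S)} \<union> {\<omega>\<in>space M. J \<omega> \<le> kappa_minus \<eta> (W * S)})"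
    by (rule finite_measure_mono) auto
  also have "\<dots> \<le> \<P>(\<omega> in M. J \<omega> \<ge> kappa_plus \<eta> (W * S)) + \<P>(\<omega> in M. J \<omega> \<le> kappa_minus \<eta> (W * S))"
    by (rule measure_Un_le) auto
  also have "\<dots> \<le> \<eta>" using upper lower by simp
  finally show ?thesis by (simp add: J_def)
qed

lemma (in stationary_linear_system) prob_cost_notin_interval:
  assumes Q: "Finite_Cartesian_Product.transpose Q = Q" "\<And>u. u \<noteq> 0 \<Longrightarrow> inner u (Q *v u) > 0"
    and N: "N \<ge> 1" and Sigma: "pos_def (Sigma_mat M N x)"
    and \<eta>: "0 < \<eta>" "\<eta> < 1" and k: "k \<ge> N - 1"
  shows "\<P>(\<omega> in M. cost Q N x k \<omega> \<notin>
           {kappa_minus \<eta> (Omega_mat N Q * Sigma_mat M N x)<..<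
            kappa_plus \<eta> (Omega_mat N Q * Sigma_mat M N x)}) \<le> \<eta>"
proof -
  let ?d = "N * CARD('n)" and ?W = "Omega_mat N Q" and ?S = "Sigma_mat M N x"
  have W: "pos_def ?W" "?W \<in> carrier_mat ?d ?d"
    using pos_def_Omega_mat[OF Q] Omega_mat_carrier by auto
  have S: "?S \<in> carrier_mat ?d ?d" by (simp add: Sigma_mat_def)
  obtain p a where
    orth: "\<forall>j<?d. \<forall>j'<?d.
      (\<Sum>i<?d. \<Sum>i'<?d. p i j * p i' j' * ?S $$ (i, i')) = (if j = j' then 1 else 0)"
    and W_eq: "\<forall>i<?d. \<forall>i'<?d. ?W $$ (i, i') = (\<Sum>j<?d. a j * p i j * p i' j)"
    and ev: "eigvals_mset (?W * ?S) = image_mset a (mset_set {..<?d})"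
    using pos_def_simultaneous_diagonalization_entries[OF W Sigma S] by (elim exE conjE) (rule that)
  \<comment> \<open>First time of the window; the truncated subtraction is exact because
    \<open>k \<ge> N - 1\<close>.\<close>
  define m where "m = k + 1 - N"
  define y where "y i = stacked (\<lambda>a. x (m + a)) i" for i
  have y_meas[measurable]: "y i \<in> borel_measurable M" for i by (simp add: y_def)
  define z where "z j \<omega> = (\<Sum>i<?d. p i j * y i \<omega>)" for j \<omega>
  have z_law: "distr M borel (\<lambda>\<omega>. \<Sum>j<?d. t j * z j \<omega>) = centred_normal (\<Sum>j<?d. (t j)\<^sup>2)" for t
  proof -
    \<comment> \<open>\<open>\<tau>\<close> is P t, so its variance is t^T (P^T Sigma P) t, the
      squared length of t.\<close>
    define \<tau> where "\<tau> i = (\<Sum>j<?d. t j * p i j)" for i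
    have "(\<Sum>j<?d. t j * z j \<omega>) = (\<Sum>i<?d. \<tau> i * y i \<omega>)" for \<omega>
      unfolding z_def \<tau>_def sum_distrib_left sum_distrib_right
      by (subst sum.swap) (simp add: mult_ac)
    moreover have "(\<Sum>i<?d. \<Sum>i'<?d. \<tau> i * \<tau> i' * ?S $$ (i, i')) = (\<Sum>j<?d. (t j)\<^sup>2)"
    proof -
      have "(\<Sum>i<?d. \<Sum>i'<?d. \<tau> i * \<tau> i' * ?S $$ (i, i'))
          = (\<Sum>i<?d. \<Sum>i'<?d. \<Sum>j<?d. \<Sum>j'<?d. t j * t j' * (p i j * p i' j' * ?S $$ (i, i')))"
        unfolding \<tau>_def sum_product by (simp add: sum_distrib_left sum_distrib_right mult_ac)
      also have "\<dots> = (\<Sum>i<?d. \<Sum>j<?d. \<Sum>i'<?d. \<Sum>j'<?d. t j * t j' * (p i j * p i' j' * ?S $$ (i, i')))"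
        by (intro sum.cong refl sum.swap)
      also have "\<dots> = (\<Sum>j<?d. \<Sum>i<?d. \<Sum>i'<?d. \<Sum>j'<?d. t j * t j' * (p i j * p i' j' * ?S $$ (i, i')))"
        by (rule sum.swap)
      also have "\<dots> = (\<Sum>j<?d. \<Sum>i<?d. \<Sum>j'<?d. \<Sum>i'<?d. t j * t j' * (p i j * p i' j' * ?S $$ (i, i')))"
        by (intro sum.cong refl sum.swap)
      also have "\<dots> = (\<Sum>j<?d. \<Sum>j'<?d. \<Sum>i<?d. \<Sum>i'<?d. t j * t j' * (p i j * p i' j' * ?S $$ (i, i')))"
        by (intro sum.cong refl sum.swap)
      also have "\<dots> = (\<Sum>j<?d. \<Sum>j'<?d. if j = j' then t j * t j' else 0)"
        by (intro sum.cong refl) (simp add: orth sum_distrib_left[symmetric])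
      also have "\<dots> = (\<Sum>j<?d. (t j)\<^sup>2)"
        by (intro sum.cong refl) (simp add: power2_eq_square)
      finally show ?thesis .
    qed
    ultimately show ?thesis
      using distr_stacked_functional[where K = N and t = \<tau> and m = m] by (simp add: y_def)
  qed
  \<comment> \<open>With y the stacked window, y^T Omega y = (P^T y)^T diag(a) (P^T y).\<close>
  have cost: "cost Q N x k \<omega> = (\<Sum>j<?d. a j * (z j \<omega>)\<^sup>2)" for \<omega>
  proof -
    have "cost Q N x k \<omega> = (\<Sum>b<N. inner (x (m + b) \<omega>) (Q *v x (m + b) \<omega>))"
    proof -
      have "{k + 1 - N..k} = {0 + m..<N + m}" using N k by (auto simp: m_def)
      then show ?thesis
        unfolding cost_def using sum.shift_bounds_nat_ivl[of "\<lambda>j. inner (x j \<omega>) (Q *v x j \<omega>)" 0 m N]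
        by (simp add: atLeast0LessThan add.commute)
    qed
    also have "\<dots> = (\<Sum>i<?d. \<Sum>i'<?d. y i \<omega> * ?W $$ (i, i') * y i' \<omega>)"
      by (rule Omega_mat_quadratic_form[symmetric]) (simp add: y_def stacked_def)
    also have "\<dots> = (\<Sum>i<?d. \<Sum>i'<?d. \<Sum>j<?d. a j * ((p i j * y i \<omega>) * (p i' j * y i' \<omega>)))"
      by (intro sum.cong refl) (simp add: W_eq sum_distrib_left sum_distrib_right mult_ac)
    also have "\<dots> = (\<Sum>i<?d. \<Sum>j<?d. \<Sum>i'<?d. a j * ((p i j * y i \<omega>) * (p i' j * y i' \<omega>)))"
      by (intro sum.cong refl sum.swap)
    also have "\<dots> = (\<Sum>j<?d. \<Sum>i<?d. \<Sum>i'<?d. a j * ((p i j * y i \<omega>) * (p i' j * y i' \<omega>)))"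
      by (rule sum.swap)
    also have "\<dots> = (\<Sum>j<?d. a j * (z j \<omega>)\<^sup>2)"
      by (simp only: z_def power2_eq_square sum_product) (simp only: sum_distrib_left)
    finally show ?thesis .
  qed
  show ?thesis
    unfolding cost
    by (rule prob_quadratic_form_notin_interval[OF W Sigma S _ \<eta> ev _ z_law]) (use N in \<open>auto simp: z_def[abs_def]\<close>)
qed

theorem theorem3:
  fixes M :: "'a measure"
    and x v :: "nat \<Rightarrow> 'a \<Rightarrow> real^'n"
    and A V X Q :: "real^'n^'n"
    and N k :: nat
    and \<eta> :: real
  assumes "prob_space M"
    and "schur_stable A"
    and "transpose V = V" and "\<And>u. inner u (V *v u) \<ge> 0"
    and "A ** X ** transpose A - X + V = 0"
    and "prob_space.indep_vars M (\<lambda>_. borel) v UNIV"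
    and "\<And>j. centred_gaussian M (v j) V"
    and "centred_gaussian M (x 0) X"
    and "prob_space.indep_set M
           (sets (vimage_algebra (space M) (x 0) borel))
           (sets (vimage_algebra (space M) (\<lambda>\<omega> j. v j \<omega>) (Pi\<^sub>M UNIV (\<lambda>_. borel))))"
    and "\<And>j \<omega>. \<omega> \<in> space M \<Longrightarrow> x (Suc j) \<omega> = A *v x j \<omega> + v j \<omega>"
    and "transpose Q = Q" and "\<And>u. u \<noteq> 0 \<Longrightarrow> inner u (Q *v u) > 0"
    and "N \<ge> 1"
    and "pos_def (Sigma_mat M N x)"
    and "0 < \<eta>" and "\<eta> < 1"
    and "k \<ge> N - 1"
  shows "\<P>(\<omega> in M. cost Q N x k \<omega> \<notin>
           {kappa_minus \<eta> (Omega_mat N Q * Sigma_mat M N x)<..<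
            kappa_plus \<eta> (Omega_mat N Q * Sigma_mat M N x)}) \<le> \<eta>"
proof -
  interpret prob_space M by (rule assms(1))
  interpret stationary_linear_system M x v A V X
    by unfold_locales (use assms lyapunov_solution_nonneg[OF assms(2,5,4)] in auto)
  show ?thesis by (rule prob_cost_notin_interval[OF assms(11-17)])
qed

end
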